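(* Let $(S)$ be a connected Hopf SDSE (with $F_i(0,\ldots,0)=1$ for all $i$) such that any vertex of $G_{(S)}$ is the descendant of a self-dependent vertex. Then $(S)$ is fundamental, with $K_0=I_1=J_1=\emptyset$. That is: the index set of $(S)$ has a partition $\big(\bigcup_{i\in I_0}J_i\big)\cup\big(\bigcup_{i\in J_0}J_i\big)$ into non-empty sets $J_i$, with $I_0$ and $J_0$ disjoint index sets, $I_0\cup J_0\neq\emptyset$, and there are scalars $(\beta_i)_{i\in I_0}$, such that up to a change of variables, writing $H_j=\sum_{y\in J_j}h_y$, $$F_x=f_{\beta_i}(H_i)\prod_{j\in I_0-\{i\}}f_{\frac{\beta_j}{1+\beta_j}}((1+\beta_j)H_j)\prod_{j\in J_0}f_1(H_j)\quad\text{for all } i\in I_0,\ x\in J_i,$$ $$F_x=\prod_{j\in I_0}f_{\frac{\beta_j}{1+\beta_j}}((1+\beta_j)H_j)\prod_{j\in J_0-\{i\}}f_1(H_j)\quad\text{for all } i\in J_0,\ x\in J_i.$$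
   Context: $K$ is a field of characteristic zero and $I$ a finite non-empty set. $\mathcal{H}_I$ is the (Connes-Kreimer) polynomial algebra generated by the set of (isomorphism classes of non-planar) rooted trees whose vertices are decorated by elements of $I$; monomials are forests; it is graded by the number of vertices, and $\widehat{\mathcal H_I}=\prod_n\mathcal H_I(n)$ is its completion. The coproduct is the algebra morphism with $\Delta(t)=t\otimes1+1\otimes t+\sum_cP^c(t)\otimes R^c(t)$ for each tree $t$, where $c$ runs over non-empty sets of edges of $t$ such that every path from the root to a leaf meets at most one edge of $c$; after deleting the edges of $c$, $R^c(t)$ is the component containing the root and $P^c(t)$ is the product of the other components. This makes $\mathcal H_I$ a Hopf algebra. $B_i^+$ is the linear (continuous) operator sending a forest to the tree obtained by grafting its trees on a common root decorated by $i$. The SDSE $(S)$ associated to non-constant series $(F_i)_{i\in I}$, $F_i\in K[[h_j,j\in I]]$, is the system $X_i=B_i^+(F_i(X_j,j\in I))$, $i\in I$; it has a unique solution $(X_i)_{i\in I}\in\widehat{\mathcal H_I}^{\,I}$. $X_i(n)$ is the homogeneous component of degree $n$ of $X_i$, and $\mathcal H_{(S)}$ is the subalgebra of $\mathcal H_I$ generated by all the $X_i(n)$. $(S)$ is Hopf if $\mathcal H_{(S)}$ is a Hopf subalgebra of $\mathcal H_I$. The graph $G_{(S)}$ has vertex set $I$ and an oriented edge $i\to j$ iff $\partial F_i/\partial h_j\ne0$; $i$ is self-dependent if $i\to i$. $j$ is a descendant of $i$ if there is an oriented path (of length $\ge1$) from $i$ to $j$. $(S)$ is connected if $G_{(S)}$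 is connected (as an undirected graph). A change of variables replaces $(F_i(h_j,j\in I))_{i\in I}$ by $(F_i(\lambda_jh_j,j\in I))_{i\in I}$ with all $\lambda_j\in K-\{0\}$. For $\beta\in K$, $f_\beta(h)=\sum_{k\ge0}\frac{(1+\beta)(1+2\beta)\cdots(1+(k-1)\beta)}{k!}h^k$, i.e. $(1-\beta h)^{-1/\beta}$ if $\beta\ne0$ and $e^h$ if $\beta=0$. Convention: $f_{\beta/\lambda}(\lambda h)$ means $\sum_{k\ge0}\frac{\lambda(\lambda+\beta)\cdots(\lambda+(k-1)\beta)}{k!}h^k$, which is also defined for $\lambda=0$ and then equals $1$. *)

theory Defs
  imports
    "HOL-Library.Multiset"
    "HOL-Library.Poly_Mapping"
    "HOL-Library.Product_Plus"
    "HOL-Library.Sublist"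
    "HOL-Library.Disjoint_Sets"
    "HOL-Computational_Algebra.Formal_Power_Series"
begin

section \<open>Multivariate formal power series\<close>

text \<open>
  A monomial in the indeterminates \<open>h\<^sub>a\<close>, with \<open>a :: 'a\<close>, is a finite multiset over \<open>'a\<close>.
  The type below is used twice: over a finite type of indices it is the ring
  \<open>K[[h\<^sub>j, j \<in> I]]\<close>; over the type of decorated rooted trees (finitely many of each degree)
  it is the completion of the Connes-Kreimer algebra with respect to its grading.
\<close>

typedef ('a, 'k) mps = "UNIV :: ('a multiset \<Rightarrow> 'k) set"
  morphisms coeff Abs_mps ..

lemma coeff_Abs_mps [simp]: "coeff (Abs_mps f) = f"
  by (simp add: Abs_mps_inverse)

lemma mps_eqI: "(\<And>m. coeff f m = coeff g m) \<Longrightarrow> f = g"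
  by (metis coeff_inject ext)

lemma finite_mset_splits [simp]: "finite {(a, b). a + b = (m :: 'a multiset)}"
proof -
  define S where "S = mset ` {xs. set xs \<subseteq> set_mset m \<and> length xs \<le> size m}"
  have "finite S"
    unfolding S_def by (intro finite_imageI finite_lists_length_le) simp
  moreover have "{(a, b). a + b = m} \<subseteq> S \<times> S"
  proof -
    have "a \<in> S" if "a \<subseteq># m" for a
    proof -
      obtain xs where xs: "a = mset xs" using ex_mset[of a] by blast
      have "set xs \<subseteq> set_mset m" "length xs \<le> size m"
        using set_mset_mono[OF that] size_mset_mono[OF that] by (simp_all add: xs)
      then show ?thesis by (auto simp: S_def xs)
    qed
    then show ?thesis by auto
  qed
  ultimately show ?thesis
    by (meson finite_SigmaI finite_subset)
qed

lemmas finite_mset_splits' [simp] = finite_mset_splits [unfolded case_prod_unfold]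

instantiation mps :: (type, comm_ring_1) comm_ring_1
begin

definition "0 = Abs_mps (\<lambda>m. 0)"
definition "1 = Abs_mps (\<lambda>m. if m = {#} then 1 else 0)"
definition "f + g = Abs_mps (\<lambda>m. coeff f m + coeff g m)"
definition "f - g = Abs_mps (\<lambda>m. coeff f m - coeff g m)"
definition "- f = Abs_mps (\<lambda>m. - coeff f m)"
definition "f * g = Abs_mps (\<lambda>m. \<Sum>(a, b) | a + b = m. coeff f a * coeff g b)"

instance
proof
  fix f g h :: "('a, 'b) mps"
  show "f * g * h = f * (g * h)"
  proof (rule mps_eqI)
    fix m
    have "coeff (f * g * h) m =
      (\<Sum>(d, c) | d + c = m. \<Sum>(a, b) | a + b = d. coeff f a * coeff g b * coeff h c)"
      by (simp add: times_mps_def sum_distrib_right case_prod_unfold)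
    also have "\<dots> = (\<Sum>(p, q) \<in> Sigma {(d, c). d + c = m} (\<lambda>(d, c). {(a, b). a + b = d}).
        coeff f (fst q) * coeff g (snd q) * coeff h (snd p))"
      by (subst sum.Sigma [symmetric]) (auto simp: case_prod_unfold intro!: sum.cong)
    also have "\<dots> = (\<Sum>(p, q) \<in> Sigma {(a, d). a + d = m} (\<lambda>(a, d). {(b, c). b + c = d}).
        coeff f (fst p) * (coeff g (fst q) * coeff h (snd q)))"
      by (rule sum.reindex_bij_witness
          [where i = "\<lambda>(p, q). ((fst p + fst q, snd q), (fst p, fst q))"
             and j = "\<lambda>(p, q). ((fst q, snd q + snd p), (snd q, snd p))"])
         (auto simp: add.assoc mult.assoc)
    also have "\<dots> = (\<Sum>(a, d) | a + d = m. \<Sum>(b, c) | b + c = d. coeff f a * (coeff g b * coeff h c))"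
      by (subst sum.Sigma [symmetric]) (auto simp: case_prod_unfold intro!: sum.cong)
    also have "\<dots> = coeff (f * (g * h)) m"
      by (simp add: times_mps_def sum_distrib_left case_prod_unfold)
    finally show "coeff (f * g * h) m = coeff (f * (g * h)) m" .
  qed
  show "f * g = g * f"
  proof (rule mps_eqI)
    fix m
    have "coeff (f * g) m = (\<Sum>(a, b) | a + b = m. coeff g a * coeff f b)"
      unfolding times_mps_def coeff_Abs_mps
      by (rule sum.reindex_bij_witness [where i = prod.swap and j = prod.swap])
         (auto simp: add.commute mult.commute)
    then show "coeff (f * g) m = coeff (g * f) m"
      by (simp add: times_mps_def)
  qed
  show "1 * f = f"
  proof (rule mps_eqI)
    fix m
    have "coeff (1 * f) m = (\<Sum>(a, b) | a + b = m. (if a = {#} then 1 else 0) * coeff f b)"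
      by (simp add: times_mps_def one_mps_def)
    also have "\<dots> = (\<Sum>(a, b) \<in> {({#} :: 'a multiset, m)}. (if a = {#} then 1 else 0) * coeff f b)"
      by (rule sum.mono_neutral_right) (auto split: if_splits)
    finally show "coeff (1 * f) m = coeff f m" by simp
  qed
  show "(f + g) * h = f * h + g * h"
    by (rule mps_eqI)
       (simp add: times_mps_def plus_mps_def distrib_right sum.distrib case_prod_unfold)
  show "(0 :: ('a, 'b) mps) \<noteq> 1"
  proof
    assume "(0 :: ('a, 'b) mps) = 1"
    then have "coeff (0 :: ('a, 'b) mps) {#} = coeff 1 {#}" by simp
    then show False by (simp add: zero_mps_def one_mps_def)
  qed
  show "f + g + h = f + (g + h)" "f + g = g + f" "0 + f = f" "- f + f = 0" "f - g = f + - g"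
    by (rule mps_eqI, simp add: plus_mps_def zero_mps_def minus_mps_def uminus_mps_def algebra_simps)+
qed

end

definition mps_var :: "'a \<Rightarrow> ('a, 'k::comm_ring_1) mps" where
  "mps_var a = Abs_mps (\<lambda>m. if m = {#a#} then 1 else 0)"

definition mps_deriv :: "'a \<Rightarrow> ('a, 'k::comm_ring_1) mps \<Rightarrow> ('a, 'k) mps" where
  "mps_deriv a f = Abs_mps (\<lambda>m. of_nat (count m a + 1) * coeff f (add_mset a m))"

text \<open>
  The substitution \<open>f(X\<^sub>a, a \<in> 'a)\<close> and, for a univariate series, \<open>f(g)\<close>. Both are meant for
  series without constant term, for which the sums below, which range over the nonzero
  summands only, are finite if \<open>'a\<close> is.
\<close>

definition mps_subst :: "('a, 'k::comm_ring_1) mps \<Rightarrow> ('a \<Rightarrow> ('b, 'k) mps) \<Rightarrow> ('b, 'k) mps" where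
  "mps_subst f X = Abs_mps (\<lambda>G. Sum_any (\<lambda>m. coeff f m * coeff (\<Prod>a\<in>#m. X a) G))"

definition fps_subst :: "'k::comm_ring_1 fps \<Rightarrow> ('a, 'k) mps \<Rightarrow> ('a, 'k) mps" where
  "fps_subst f g = Abs_mps (\<lambda>m. Sum_any (\<lambda>k. fps_nth f k * coeff (g ^ k) m))"

text \<open>The series \<open>f(\<lambda>\<^sub>a h\<^sub>a, a \<in> 'a)\<close>.\<close>

definition rescale :: "('a \<Rightarrow> 'k) \<Rightarrow> ('a, 'k::comm_ring_1) mps \<Rightarrow> ('a, 'k) mps" where
  "rescale l f = Abs_mps (\<lambda>m. (\<Prod>a\<in>#m. l a) * coeff f m)"


section \<open>Decorated rooted trees\<close>

datatype 'i tree = Node 'i "'i tree multiset"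

type_synonym 'i forest = "'i tree multiset"

primrec num_vertices :: "'i tree \<Rightarrow> nat" where
  "num_vertices (Node i ts) = Suc (\<Sum>n\<in>#image_mset num_vertices ts. n)"

definition forest_degree :: "'i forest \<Rightarrow> nat" where
  "forest_degree G = (\<Sum>t\<in>#G. num_vertices t)"

text \<open>
  To speak about individual vertices and edges of a tree we use a plane representative of it.
  A vertex is given by the list of child indices on the path from the root to it, and an edge
  by its lower end, i.e. by a vertex other than the root.
\<close>

datatype 'i plane_tree = PNode 'i "'i plane_tree list"

primrec tree_of :: "'i plane_tree \<Rightarrow> 'i tree" where
  "tree_of (PNode i ps) = Node i (mset (map tree_of ps))"

lemma size_nth_less [termination_simp]: "k < length ps \<Longrightarrow> size (ps ! k) < Suc (size_list size ps)"
  by (metis less_Suc_eq_le nth_mem order_refl size_list_estimation')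

fun vertices :: "'i plane_tree \<Rightarrow> nat list set" where
  "vertices (PNode i ps) = insert [] (\<Union>k\<in>{..<length ps}. (#) k ` vertices (ps ! k))"

definition edges :: "'i plane_tree \<Rightarrow> nat list set" where
  "edges p = vertices p - {[]}"

definition leaves :: "'i plane_tree \<Rightarrow> nat list set" where
  "leaves p = {v \<in> vertices p. \<forall>w \<in> vertices p. \<not> strict_prefix v w}"

text \<open>The edges of the path from the root to the vertex \<open>v\<close> are the nonempty prefixes of \<open>v\<close>.\<close>

definition path_edges :: "nat list \<Rightarrow> nat list set" where
  "path_edges v = {e. e \<noteq> [] \<and> prefix e v}"

definition admissible_cuts :: "'i plane_tree \<Rightarrow> nat list set set" where
  "admissible_cuts p =
     {c. c \<noteq> {} \<and> c \<subseteq> edges p \<and> (\<forall>v \<in> leaves p. card (path_edges v \<inter> c) \<le> 1)}"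

text \<open>
  \<open>component c v p\<close>: here \<open>p\<close> is the full subtree rooted at the vertex \<open>v\<close> of an ambient tree;
  the result is the connected component that has \<open>v\<close> as its root once the edges in \<open>c\<close> are deleted
  from the ambient tree.
\<close>

function component :: "nat list set \<Rightarrow> nat list \<Rightarrow> 'i plane_tree \<Rightarrow> 'i tree" where
  "component c v (PNode i ps) =
     Node i (mset (map (\<lambda>k. component c (v @ [k]) (ps ! k))
                       (filter (\<lambda>k. v @ [k] \<notin> c) [0..<length ps])))"
  by pat_completeness auto
termination
  by (relation "measure (\<lambda>(c, v, p). size p)") (auto simp: size_nth_less)

fun subtree_at :: "'i plane_tree \<Rightarrow> nat list \<Rightarrow> 'i plane_tree" where
  "subtree_at p [] = p"
| "subtree_at (PNode i ps) (k # v) = subtree_at (ps ! k) v"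

definition trunk :: "nat list set \<Rightarrow> 'i plane_tree \<Rightarrow> 'i tree" where
  "trunk c p = component c [] p"

definition pruned_part :: "nat list set \<Rightarrow> 'i plane_tree \<Rightarrow> 'i forest" where
  "pruned_part c p = {#component c v (subtree_at p v). v \<in># mset_set c#}"


section \<open>The Connes-Kreimer Hopf algebra\<close>

text \<open>
  The polynomial algebra over the trees is the monoid algebra of the additive monoid of forests,
  and its tensor square is the monoid algebra of the monoid of pairs of forests.
\<close>

type_synonym ('i, 'k) ck = "'i forest \<Rightarrow>\<^sub>0 'k"
type_synonym ('i, 'k) ck_tensor = "('i forest \<times> 'i forest) \<Rightarrow>\<^sub>0 'k"

abbreviation ck_const :: "'k::comm_ring_1 \<Rightarrow> ('i, 'k) ck" where
  "ck_const c \<equiv> Poly_Mapping.single {#} c"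

definition tensor :: "('i, 'k::comm_ring_1) ck \<Rightarrow> ('i, 'k) ck \<Rightarrow> ('i, 'k) ck_tensor" where
  "tensor x y = (\<Sum>F\<in>Poly_Mapping.keys x. \<Sum>G\<in>Poly_Mapping.keys y.
     Poly_Mapping.single (F, G) (Poly_Mapping.lookup x F * Poly_Mapping.lookup y G))"

definition cut_coproduct :: "'i plane_tree \<Rightarrow> ('i, 'k::comm_ring_1) ck_tensor" where
  "cut_coproduct p = (\<Sum>c\<in>admissible_cuts p.
     Poly_Mapping.single (pruned_part c p, {#trunk c p#}) 1)"

text \<open>The sum over the cuts does not depend on the choice of the plane representative.\<close>

definition tree_coproduct :: "'i tree \<Rightarrow> ('i, 'k::comm_ring_1) ck_tensor" where
  "tree_coproduct t =
     Poly_Mapping.single ({#t#}, {#}) 1 + Poly_Mapping.single ({#}, {#t#}) 1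
     + cut_coproduct (SOME p. tree_of p = t)"

definition coproduct :: "('i, 'k::comm_ring_1) ck \<Rightarrow> ('i, 'k) ck_tensor" where
  "coproduct x = (\<Sum>F\<in>Poly_Mapping.keys x.
     Poly_Mapping.single ({#}, {#}) (Poly_Mapping.lookup x F) * (\<Prod>t\<in>#F. tree_coproduct t))"

definition counit :: "('i, 'k::comm_ring_1) ck \<Rightarrow> 'k" where
  "counit x = Poly_Mapping.lookup x {#}"

definition ck_linear :: "(('i, 'k::comm_ring_1) ck \<Rightarrow> ('i, 'k) ck) \<Rightarrow> bool" where
  "ck_linear S \<longleftrightarrow> (\<forall>x y. S (x + y) = S x + S y) \<and> (\<forall>c x. S (ck_const c * x) = ck_const c * S x)"

definition convolution ::
  "(('i, 'k::comm_ring_1) ck \<Rightarrow> ('i, 'k) ck) \<Rightarrow> (('i, 'k) ck \<Rightarrow> ('i, 'k) ck) \<Rightarrow>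
   ('i, 'k) ck \<Rightarrow> ('i, 'k) ck" where
  "convolution S T x = (\<Sum>(F, G)\<in>Poly_Mapping.keys (coproduct x).
     ck_const (Poly_Mapping.lookup (coproduct x) (F, G))
     * S (Poly_Mapping.single F 1) * T (Poly_Mapping.single G 1))"

definition is_antipode :: "(('i, 'k::comm_ring_1) ck \<Rightarrow> ('i, 'k) ck) \<Rightarrow> bool" where
  "is_antipode S \<longleftrightarrow> ck_linear S \<and>
     convolution S id = (\<lambda>x. ck_const (counit x)) \<and> convolution id S = (\<lambda>x. ck_const (counit x))"

definition subalgebra :: "('i, 'k::comm_ring_1) ck set \<Rightarrow> bool" where
  "subalgebra A \<longleftrightarrow> 1 \<in> A \<and> (\<forall>x\<in>A. \<forall>y\<in>A. x + y \<in> A \<and> x * y \<in> A) \<and>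
     (\<forall>c. \<forall>x\<in>A. ck_const c * x \<in> A)"

definition generated_subalgebra :: "('i, 'k::comm_ring_1) ck set \<Rightarrow> ('i, 'k) ck set" where
  "generated_subalgebra B = \<Inter>{A. subalgebra A \<and> B \<subseteq> A}"

definition tensor_square :: "('i, 'k::comm_ring_1) ck set \<Rightarrow> ('i, 'k) ck_tensor set" where
  "tensor_square A = {\<Sum>k<n. tensor (a k) (b k) | (n::nat) a b. \<forall>k<n. a k \<in> A \<and> b k \<in> A}"

text \<open>At most one \<open>S\<close> satisfies \<open>is_antipode S\<close>, as it is a convolution inverse of the identity.\<close>

definition hopf_subalgebra :: "('i, 'k::comm_ring_1) ck set \<Rightarrow> bool" where
  "hopf_subalgebra A \<longleftrightarrow> subalgebra A \<and> coproduct ` A \<subseteq> tensor_square A \<and>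
     (\<forall>S. is_antipode S \<longrightarrow> S ` A \<subseteq> A)"


section \<open>Systems of Dyson-Schwinger equations\<close>

text \<open>The continuous linear operator that maps a forest \<open>G\<close> to the tree \<open>Node i G\<close>.\<close>

definition B_plus :: "'i \<Rightarrow> ('i tree, 'k::comm_ring_1) mps \<Rightarrow> ('i tree, 'k) mps" where
  "B_plus i X = Abs_mps (\<lambda>F. \<Sum>G | F = {#Node i G#}. coeff X G)"

definition is_solution ::
  "('i \<Rightarrow> ('i, 'k::comm_ring_1) mps) \<Rightarrow> ('i \<Rightarrow> ('i tree, 'k) mps) \<Rightarrow> bool" where
  "is_solution F X \<longleftrightarrow> (\<forall>i. X i = B_plus i (mps_subst (F i) X))"

definition solution :: "('i \<Rightarrow> ('i, 'k::comm_ring_1) mps) \<Rightarrow> 'i \<Rightarrow> ('i tree, 'k) mps" where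
  "solution F = (THE X. is_solution F X)"

lemma finite_bounded_msets: "finite A \<Longrightarrow> finite {M. set_mset M \<subseteq> A \<and> size M \<le> n}"
proof (rule finite_subset)
  show "{M. set_mset M \<subseteq> A \<and> size M \<le> n} \<subseteq> mset ` {xs. set xs \<subseteq> A \<and> length xs \<le> n}"
  proof
    fix M assume M: "M \<in> {M. set_mset M \<subseteq> A \<and> size M \<le> n}"
    obtain xs where "M = mset xs" using ex_mset[of M] by blast
    with M show "M \<in> mset ` {xs. set xs \<subseteq> A \<and> length xs \<le> n}" by auto
  qed
qed (intro finite_imageI finite_lists_length_le)

lemma forest_degree_empty [simp]: "forest_degree {#} = 0"
  and forest_degree_add_mset [simp]: "forest_degree (add_mset t G) = num_vertices t + forest_degree G"
  and forest_degree_plus [simp]: "forest_degree (G + H) = forest_degree G + forest_degree H"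
  by (simp_all add: forest_degree_def)

lemma num_vertices_Node: "num_vertices (Node i G) = Suc (forest_degree G)"
  by (simp add: forest_degree_def)

lemma num_vertices_pos: "0 < num_vertices t"
  by (cases t) simp

lemma num_vertices_le: "t \<in># G \<Longrightarrow> num_vertices t \<le> forest_degree G"
  by (metis forest_degree_add_mset insert_DiffM le_add1)

lemma size_le_forest_degree: "size G \<le> forest_degree G"
proof (induction G)
  case (add t G)
  then show ?case using num_vertices_pos[of t] by simp
qed simp

lemma finite_trees: "finite {t :: 'i::finite tree. num_vertices t \<le> n}"
proof (induction n)
  case 0
  then show ?case using num_vertices_pos by (metis (mono_tags, lifting) Collect_empty_eq finite.emptyI leD)
next
  case (Suc n)
  have "{t :: 'i tree. num_vertices t \<le> Suc n} \<subseteq>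
    (\<lambda>(i, G). Node i G) ` (UNIV \<times> {G. set_mset G \<subseteq> {t. num_vertices t \<le> n} \<and> size G \<le> n})"
  proof
    fix t :: "'i tree" assume "t \<in> {t. num_vertices t \<le> Suc n}"
    then obtain i G where t: "t = Node i G" "forest_degree G \<le> n"
      by (cases t) (auto simp: num_vertices_Node simp del: num_vertices.simps)
    then have "set_mset G \<subseteq> {t. num_vertices t \<le> n}" "size G \<le> n"
      using num_vertices_le size_le_forest_degree order_trans by blast+
    with t show "t \<in> (\<lambda>(i, G). Node i G) ` (UNIV \<times> {G. set_mset G \<subseteq> {t. num_vertices t \<le> n} \<and> size G \<le> n})"
      by auto
  qed
  then show ?case
    by (rule finite_subset) (intro finite_imageI finite_cartesian_product finite_bounded_msets Suc finite)
qed

lemma finite_forests: "finite {G :: 'i::finite forest. forest_degree G = n}"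
proof (rule finite_subset)
  show "{G :: 'i forest. forest_degree G = n} \<subseteq> {G. set_mset G \<subseteq> {t. num_vertices t \<le> n} \<and> size G \<le> n}"
    using num_vertices_le size_le_forest_degree by blast
qed (intro finite_bounded_msets finite_trees)

lemma coeff_mult: "coeff (f * g) m = (\<Sum>(a, b) | a + b = m. coeff f a * coeff g b)"
  by (simp add: times_mps_def)

lemma coeff_prod_mset_cong:
  assumes "\<And>a H. H \<subseteq># G \<Longrightarrow> coeff (X a) H = coeff (Y a) H"
  shows "coeff (\<Prod>a\<in>#m. X a) G = coeff (\<Prod>a\<in>#m. Y a) G"
  using assms
proof (induction m arbitrary: G)
  case (add a m)
  show ?case unfolding image_mset_add_mset prod_mset.add_mset coeff_mult
  proof (rule sum.cong, rule refl, clarify)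
    fix A B assume G: "G = A + B"
    have "coeff (\<Prod>a\<in>#m. X a) B = coeff (\<Prod>a\<in>#m. Y a) B"
      by (rule add.IH) (metis G add.prems mset_subset_eq_add_right subset_mset.order_trans)
    moreover have "coeff (X a) A = coeff (Y a) A"
      by (rule add.prems) (simp add: G)
    ultimately show "coeff (X a) A * coeff (\<Prod>a\<in>#m. X a) B = coeff (Y a) A * coeff (\<Prod>a\<in>#m. Y a) B"
      by simp
  qed
qed simp

lemma coeff_mps_subst_cong:
  assumes "\<And>a H. H \<subseteq># G \<Longrightarrow> coeff (X a) H = coeff (Y a) H"
  shows "coeff (mps_subst f X) G = coeff (mps_subst f Y) G"
proof -
  have "coeff (\<Prod>a\<in>#m. X a) G = coeff (\<Prod>a\<in>#m. Y a) G" for m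
    by (rule coeff_prod_mset_cong) (rule assms)
  then show ?thesis by (simp add: mps_subst_def)
qed

lemma coeff_B_plus_Node [simp]: "coeff (B_plus i X) {#Node i G#} = coeff X G"
proof -
  have "{H. {#Node i G#} = {#Node i H#}} = {G}" by auto
  then show ?thesis by (simp add: B_plus_def)
qed

lemma coeff_B_plus_other: "(\<And>G. F \<noteq> {#Node i G#}) \<Longrightarrow> coeff (B_plus i X) F = 0"
  by (simp add: B_plus_def)

lemma forest_degree_mono: "G \<subseteq># H \<Longrightarrow> forest_degree G \<le> forest_degree H"
  by (metis forest_degree_plus le_add1 subset_mset.le_iff_add)

lemma coeff_B_plus_subst_cong:
  assumes "\<And>a H. forest_degree H < forest_degree G \<Longrightarrow> coeff (X a) H = coeff (Y a) H"
  shows "coeff (B_plus i (mps_subst f X)) G = coeff (B_plus i (mps_subst f Y)) G"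
proof (cases "\<exists>H. G = {#Node i H#}")
  case True
  then obtain H where G: "G = {#Node i H#}" by blast
  have "coeff (mps_subst f X) H = coeff (mps_subst f Y) H"
    by (rule coeff_mps_subst_cong, rule assms)
       (use forest_degree_mono[of _ H] in \<open>simp add: G num_vertices_Node less_Suc_eq_le del: num_vertices.simps\<close>)
  then show ?thesis by (simp add: G)
next
  case False
  then show ?thesis by (simp add: coeff_B_plus_other)
qed

theorem unique_solution: "\<exists>!X. is_solution F X"
proof
  define step where "step = (\<lambda>X i. B_plus i (mps_subst (F i) X))"
  define Y where "Y n = (step ^^ n) (\<lambda>_. 0)" for n
  have Y_Suc: "Y (Suc n) i = B_plus i (mps_subst (F i) (Y n))" for n i
    by (simp add: Y_def step_def)
  have stable: "coeff (Y n i) G = coeff (Y n' i) G"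
    if "forest_degree G < n" "forest_degree G < n'" for n n' i G
    using that
  proof (induction n arbitrary: n' i G)
    case (Suc n)
    then obtain m where m: "n' = Suc m" by (cases n') auto
    show ?case unfolding m Y_Suc
      by (rule coeff_B_plus_subst_cong, rule Suc.IH) (use Suc.prems m in auto)
  qed simp
  define X where "X i = Abs_mps (\<lambda>G. coeff (Y (Suc (forest_degree G)) i) G)" for i
  have "X i = B_plus i (mps_subst (F i) X)" for i
  proof (rule mps_eqI)
    fix G
    have "coeff (X i) G = coeff (B_plus i (mps_subst (F i) (Y (forest_degree G)))) G"
      by (simp only: X_def coeff_Abs_mps Y_Suc)
    also have "\<dots> = coeff (B_plus i (mps_subst (F i) X)) G"
      by (rule coeff_B_plus_subst_cong) (auto simp: X_def intro!: stable)
    finally show "coeff (X i) G = coeff (B_plus i (mps_subst (F i) X)) G" .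
  qed
  then show "is_solution F X" by (simp add: is_solution_def)
  fix Z assume Z: "is_solution F Z"
  have "coeff (Z i) G = coeff (X i) G" for i G
  proof (induction "forest_degree G" arbitrary: i G rule: less_induct)
    case less
    have "coeff (Z i) G = coeff (B_plus i (mps_subst (F i) Z)) G"
      using Z by (metis is_solution_def)
    also have "\<dots> = coeff (B_plus i (mps_subst (F i) X)) G"
      by (rule coeff_B_plus_subst_cong) (rule less)
    also have "\<dots> = coeff (X i) G" using \<open>is_solution F X\<close> by (metis is_solution_def)
    finally show ?case .
  qed
  then show "Z = X" by (intro ext mps_eqI)
qed

lemma is_solution_solution: "is_solution F (solution F)"
  unfolding solution_def by (rule theI' [OF unique_solution])

definition homogeneous_part :: "nat \<Rightarrow> ('i tree, 'k::comm_ring_1) mps \<Rightarrow> ('i, 'k) ck" where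
  "homogeneous_part n X = Abs_poly_mapping (\<lambda>F. coeff X F when forest_degree F = n)"

lemma lookup_homogeneous_part:
  fixes X :: "('i::finite tree, 'k::comm_ring_1) mps"
  shows "Poly_Mapping.lookup (homogeneous_part n X) G = (coeff X G when forest_degree G = n)"
proof -
  have "finite {G. (coeff X G when forest_degree G = n) \<noteq> 0}"
    by (rule finite_subset[OF _ finite_forests[of n]]) (auto simp: when_def split: if_splits)
  then show ?thesis
    by (simp add: homogeneous_part_def)
qed

definition sdse_algebra :: "('i \<Rightarrow> ('i, 'k::comm_ring_1) mps) \<Rightarrow> ('i, 'k) ck set" where
  "sdse_algebra F = generated_subalgebra {homogeneous_part n (solution F i) | i n. True}"

definition hopf_sdse :: "('i \<Rightarrow> ('i, 'k::comm_ring_1) mps) \<Rightarrow> bool" where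
  "hopf_sdse F \<longleftrightarrow> hopf_subalgebra (sdse_algebra F)"

definition sdse_edge :: "('i \<Rightarrow> ('i, 'k::comm_ring_1) mps) \<Rightarrow> 'i \<Rightarrow> 'i \<Rightarrow> bool" where
  "sdse_edge F i j \<longleftrightarrow> mps_deriv j (F i) \<noteq> 0"

definition self_dependent :: "('i \<Rightarrow> ('i, 'k::comm_ring_1) mps) \<Rightarrow> 'i \<Rightarrow> bool" where
  "self_dependent F i \<longleftrightarrow> sdse_edge F i i"

definition descendant :: "('i \<Rightarrow> ('i, 'k::comm_ring_1) mps) \<Rightarrow> 'i \<Rightarrow> 'i \<Rightarrow> bool" where
  "descendant F i j \<longleftrightarrow> (sdse_edge F)\<^sup>+\<^sup>+ i j"

definition connected_sdse :: "('i \<Rightarrow> ('i, 'k::comm_ring_1) mps) \<Rightarrow> bool" where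
  "connected_sdse F \<longleftrightarrow> (\<forall>i j. equivclp (sdse_edge F) i j)"

text \<open>
  \<open>f_conv \<beta> l\<close> stands for the series \<open>f\<^bsub>\<beta>/l\<^esub>(l h)\<close>, whose coefficients are polynomial
  in \<open>l\<close>, so that \<open>l = 0\<close> makes sense and gives the series 1.
\<close>

definition f_series :: "'k::field_char_0 \<Rightarrow> 'k fps" where
  "f_series \<beta> = Abs_fps (\<lambda>k. (\<Prod>j=1..<k. 1 + of_nat j * \<beta>) / fact k)"

definition f_conv :: "'k::field_char_0 \<Rightarrow> 'k \<Rightarrow> 'k fps" where
  "f_conv \<beta> l = Abs_fps (\<lambda>k. (\<Prod>j<k. l + of_nat j * \<beta>) / fact k)"

definition block_sum :: "'i set \<Rightarrow> ('i, 'k::comm_ring_1) mps" where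
  "block_sum A = (\<Sum>y\<in>A. mps_var y)"

end

(*
  Write a_t for the coefficient of a tree t in X_(root t), and c_i(m) for the partial derivative at 0
  of F_i along the multiset m. Then a_(B_i(G)) is, up to the symmetry factor of G, the product of
  c_i(roots of G) and of the coefficients of the trees of G.

  Taking the terms (leaf j) (x) t' in the coproduct of X_i(n+1), the Hopf property says that deleting
  a leaf j in all possible ways maps X_i(n+1) to a multiple Lambda_j(i,n) of X_i(n). Reading this off
  at the tree B_i(G) gives
    c_i(roots G + j) = (Lambda_j(i, 1 + |G|) - sum of Lambda_j(root s, |s|) over s in G) c_i(roots G)
  whenever the coefficients of the trees of G do not vanish. At a self-dependent vertex the ladders
  show that Lambda_j(i,n) is affine in n with slope b_j; this passes on to the descendants with the
  same slope, and connectedness makes b global. With a_kj = c_k(j), corollas then yield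
    c_k(m + j) = (a_kj + sum of (b_j - a_lj) over l in m) c_k(m).
  The symmetry of c_k in its arguments up to order three forces b_j - a_lj to vanish between
  different blocks and, after rescaling, to be constant inside a block.
*)
theory Submission
  imports Defs
begin

section \<open>Coefficients of the solution and linear parts\<close>

lemma lookup_tensor:
  "Poly_Mapping.lookup (tensor x y) (F, G) = Poly_Mapping.lookup x F * Poly_Mapping.lookup y G"
proof -
  have "Poly_Mapping.lookup (tensor x y) (F, G) =
    (\<Sum>F'\<in>Poly_Mapping.keys x. \<Sum>G'\<in>Poly_Mapping.keys y.
      if F' = F then if G' = G then Poly_Mapping.lookup x F * Poly_Mapping.lookup y G else 0 else 0)"
    by (simp add: tensor_def lookup_sum lookup_single) (intro sum.cong refl, auto simp: when_def)
  also have "\<dots> = (\<Sum>F'\<in>Poly_Mapping.keys x.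
      if F' = F then Poly_Mapping.lookup x F * Poly_Mapping.lookup y G else 0)"
    by (intro sum.cong refl) (auto simp: in_keys_iff)
  also have "\<dots> = Poly_Mapping.lookup x F * Poly_Mapping.lookup y G"
    by (auto simp: in_keys_iff)
  finally show ?thesis .
qed

lemma lookup_mult_eq_sum:
  fixes x y :: "('a::type multiset \<Rightarrow>\<^sub>0 'k::comm_ring_1)"
  shows "Poly_Mapping.lookup (x * y) m =
    (\<Sum>(a, b) | a + b = m. Poly_Mapping.lookup x a * Poly_Mapping.lookup y b)"
proof -
  have "Poly_Mapping.lookup (x * y) m = 
     Sum_any (\<lambda>(a, b). Poly_Mapping.lookup x a * Poly_Mapping.lookup y b when m = a + b)"
    by (simp add: times_poly_mapping.rep_eq prod_fun_unfold_prod)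
  also have "\<dots> = (\<Sum>(a, b) | a + b = m. Poly_Mapping.lookup x a * Poly_Mapping.lookup y b when m = a + b)"
    by (rule Sum_any.expand_superset) (auto simp: when_def split: if_splits)
  also have "\<dots> = (\<Sum>(a, b) | a + b = m. Poly_Mapping.lookup x a * Poly_Mapping.lookup y b)"
    by (rule sum.cong) auto
  finally show ?thesis .
qed

lemma splits_single: "{(a, b). a + b = {#t#}} = {({#}, {#t#}), ({#t#}, {#})}"
  by (auto simp: union_is_single)

lemma lookup_mult_single:
  "Poly_Mapping.lookup ((x :: ('a multiset \<Rightarrow>\<^sub>0 'k::comm_ring_1)) * y) {#t#} =
     Poly_Mapping.lookup x {#} * Poly_Mapping.lookup y {#t#}
     + Poly_Mapping.lookup x {#t#} * Poly_Mapping.lookup y {#}"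
  by (simp add: lookup_mult_eq_sum splits_single)

primrec root_label :: "'i tree \<Rightarrow> 'i" where
  "root_label (Node i G) = i"

text \<open>No component index is carried along: a tree can occur in \<open>solution F i\<close>
  only if its root is decorated by \<open>i\<close>.\<close>

definition tree_coeff :: "('i \<Rightarrow> ('i, 'k::comm_ring_1) mps) \<Rightarrow> 'i tree \<Rightarrow> 'k" where
  "tree_coeff F t = coeff (solution F (root_label t)) {#t#}"

lemma coeff_solution:
  "coeff (solution F i) G =
     (if \<exists>H. G = {#Node i H#} then tree_coeff F (the_elem (set_mset G)) else 0)"
proof -
  have *: "solution F i = B_plus i (mps_subst (F i) (solution F))"
    using is_solution_solution[of F] unfolding is_solution_def by blast
  show ?thesis
  proof (cases "\<exists>H. G = {#Node i H#}")
    case True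
    then show ?thesis by (auto simp: tree_coeff_def)
  next
    case False
    then have "coeff (B_plus i (mps_subst (F i) (solution F))) G = 0"
      by (intro coeff_B_plus_other) auto
    then show ?thesis using False * by simp
  qed
qed

lemma tree_coeff_Node:
  "tree_coeff F (Node i G) = coeff (mps_subst (F i) (solution F)) G"
  using is_solution_solution[of F] unfolding is_solution_def tree_coeff_def
  by (metis coeff_B_plus_Node root_label.simps)

lemma coeff_solution_single:
  "coeff (solution F i) {#t#} = (if root_label t = i then tree_coeff F t else 0)"
  by (cases t) (auto simp: coeff_solution)

lemma coeff_solution_neq_single: "size G \<noteq> 1 \<Longrightarrow> coeff (solution F i) G = 0"
  by (auto simp: coeff_solution)

text \<open>Products contribute to the coefficient of a single tree only through constant terms,
  so the linear parts of all elements are combinations of the generators.\<close>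

lemma sdse_algebra_linear_part:
  fixes F :: "'i::finite \<Rightarrow> ('i, 'k::comm_ring_1) mps"
  assumes "x \<in> sdse_algebra F"
  shows "\<exists>c. \<forall>t. root_label t = i \<and> num_vertices t = n \<longrightarrow> Poly_Mapping.lookup x {#t#} = c * tree_coeff F t"
proof -
  define S where "S = {x :: ('i, 'k) ck. \<forall>i n. \<exists>c. \<forall>t. root_label t = i \<and> num_vertices t = n \<longrightarrow>
     Poly_Mapping.lookup x {#t#} = c * tree_coeff F t}"
  have "subalgebra S"
    unfolding subalgebra_def
  proof (intro conjI ballI allI)
    have "Poly_Mapping.lookup (1 :: ('i, 'k) ck) {#t#} = 0 * tree_coeff F t" for t
      by (simp add: lookup_one)
    then show "1 \<in> S" unfolding S_def by blast
  next
    fix x y assume xy: "x \<in> S" "y \<in> S"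
    show "x + y \<in> S" "x * y \<in> S"
      unfolding S_def
    proof (safe)
      fix i n
      obtain c d where c: "\<And>t. root_label t = i \<and> num_vertices t = n \<Longrightarrow> Poly_Mapping.lookup x {#t#} = c * tree_coeff F t"
        and d: "\<And>t. root_label t = i \<and> num_vertices t = n \<Longrightarrow> Poly_Mapping.lookup y {#t#} = d * tree_coeff F t"
        using xy unfolding S_def by blast
      show "\<exists>c. \<forall>t. root_label t = i \<and> num_vertices t = n \<longrightarrow> Poly_Mapping.lookup (x + y) {#t#} = c * tree_coeff F t"
        by (rule exI[of _ "c + d"]) (simp add: c d lookup_add algebra_simps)
      show "\<exists>c. \<forall>t. root_label t = i \<and> num_vertices t = n \<longrightarrow> Poly_Mapping.lookup (x * y) {#t#} = c * tree_coeff F t"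
        by (rule exI[of _ "Poly_Mapping.lookup x {#} * d + c * Poly_Mapping.lookup y {#}"])
          (simp add: c d lookup_mult_single algebra_simps)
    qed
  next
    fix c x assume "x \<in> S"
    then show "ck_const c * x \<in> S"
      unfolding S_def
      by (clarsimp simp: lookup_mult_single lookup_single) (metis mult.assoc)
  qed
  moreover have "{homogeneous_part n (solution F i) | i n. True} \<subseteq> S"
  proof (clarsimp simp: S_def)
    fix i n i' n'
    show "\<exists>c. \<forall>t. root_label t = i' \<and> num_vertices t = n' \<longrightarrow>
      Poly_Mapping.lookup (homogeneous_part n (solution F i)) {#t#} = c * tree_coeff F t"
      by (rule exI[of _ "if i = i' \<and> n = n' then 1 else 0"])
        (auto simp: lookup_homogeneous_part coeff_solution_single when_def)
  qed
  ultimately have "x \<in> S"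
    using assms unfolding sdse_algebra_def generated_subalgebra_def by blast
  then show ?thesis by (simp add: S_def)
qed

text \<open>Fixing the forest \<open>G\<close> in the left tensor factors leaves a linear
  combination of the right factors, and each of these lies in the algebra.\<close>

lemma tensor_square_sdse_algebra_linear_part:
  fixes F :: "'i::finite \<Rightarrow> ('i, 'k::comm_ring_1) mps"
  assumes "z \<in> tensor_square (sdse_algebra F)"
  shows "\<exists>c. \<forall>t. root_label t = i \<and> num_vertices t = n \<longrightarrow> Poly_Mapping.lookup z (G, {#t#}) = c * tree_coeff F t"
proof -
  obtain N :: nat and x y where z: "z = (\<Sum>k<N. tensor (x k) (y k))" and y: "\<And>k. k < N \<Longrightarrow> y k \<in> sdse_algebra F"
    using assms unfolding tensor_square_def by blast
  obtain c where c: "\<And>k t. k < N \<Longrightarrow> root_label t = i \<and> num_vertices t = n \<Longrightarrow> 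
      Poly_Mapping.lookup (y k) {#t#} = c k * tree_coeff F t"
    using sdse_algebra_linear_part[OF y, of _ i n] by metis
  have "Poly_Mapping.lookup z (G, {#t#}) = (\<Sum>k<N. Poly_Mapping.lookup (x k) G * c k) * tree_coeff F t"
    if "root_label t = i \<and> num_vertices t = n" for t
    by (simp add: z lookup_sum lookup_tensor c[OF _ that] sum_distrib_right mult.assoc)
  then show ?thesis by blast
qed

section \<open>Deletion of leaves\<close>

abbreviation leaf :: "'i \<Rightarrow> 'i tree" where
  "leaf j \<equiv> Node j {#}"

text \<open>A multiset, because different leaves may leave the same tree and these multiplicities
  become coefficients of the coproduct. The root is never deleted, since \<open>edges\<close>
  excludes it.\<close>

definition leaf_deletions :: "'i \<Rightarrow> 'i plane_tree \<Rightarrow> 'i tree multiset" where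
  "leaf_deletions j p = image_mset (\<lambda>v. trunk {v} p) (mset_set {v \<in> edges p. subtree_at p v = PNode j []})"

lemma finite_vertices [simp]: "finite (vertices p)"
  by (induction p rule: vertices.induct) auto

lemma finite_edges [simp]: "finite (edges p)"
  by (simp add: edges_def)

lemma Nil_in_vertices [simp]: "[] \<in> vertices p"
  by (cases p) simp

text \<open>The recursion tests only proper extensions of \<open>v\<close> for membership in
  \<open>c\<close>, so without any of them in \<open>c\<close> nothing is removed.\<close>

lemma component_unaffected:
  "(\<And>e. e \<in> c \<Longrightarrow> \<not> strict_prefix v e) \<Longrightarrow> component c v p = tree_of p"
proof (induction c v p rule: component.induct)
  case (1 c v i ps)
  have ni: "v @ [k] \<notin> c" for k
    using "1.prems"[of "v @ [k]"] by (auto simp: strict_prefix_def)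
  have "component c (v @ [k]) (ps ! k) = tree_of (ps ! k)" if "k < length ps" for k
  proof (rule "1.IH")
    show "k \<in> set (filter (\<lambda>k. v @ [k] \<notin> c) [0..<length ps])" using that ni by simp
    show "\<not> strict_prefix (v @ [k]) e" if "e \<in> c" for e
      using "1.prems"[OF that] by (auto simp: strict_prefix_def prefix_def)
  qed
  then have "map (\<lambda>k. component c (v @ [k]) (ps ! k)) [0..<length ps] = map tree_of ps"
    by (intro nth_equalityI) auto
  moreover have "filter (\<lambda>k. v @ [k] \<notin> c) [0..<length ps] = [0..<length ps]"
    using ni by simp
  ultimately show ?case by simp
qed

text \<open>Addresses matter only relative to the root of the subtree. Hence a deletion inside a
  child can be computed in this child as a tree of its own.\<close>

lemma component_append: "component ((@) w ` c) (w @ v) p = component c v p"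
proof (induction c v p rule: component.induct)
  case (1 c v i ps)
  have eq: "w @ v @ [k] \<in> (@) w ` c \<longleftrightarrow> v @ [k] \<in> c" for k
    by auto
  have "map (\<lambda>k. component ((@) w ` c) (w @ v @ [k]) (ps ! k)) (filter (\<lambda>k. v @ [k] \<notin> c) [0..<length ps]) =
    map (\<lambda>k. component c (v @ [k]) (ps ! k)) (filter (\<lambda>k. v @ [k] \<notin> c) [0..<length ps])"
    by (rule map_cong[OF refl], rule 1) assumption
  then show ?case
    by (simp only: component.simps append_assoc eq)
qed

lemma component_Cons: "component {k # u} [k] p = component {u} [] p"
  using component_append[of "[k]" "{u}" "[]" p] by simp

lemma mset_map_filter_upt_neq:
  assumes "k < n"
  shows "add_mset (f k) (mset (map f (filter (\<lambda>l. l \<noteq> k) [0..<n]))) = mset (map f [0..<n])"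
proof -
  have "{0..<n} = insert k {l. l < n \<and> l \<noteq> k}"
    using assms by auto
  then have "mset [0..<n] = mset_set (insert k {l. l < n \<and> l \<noteq> k})"
    by simp
  also have "\<dots> = add_mset k (mset (filter (\<lambda>l. l \<noteq> k) [0..<n]))"
    by simp
  finally show ?thesis by (metis image_mset_add_mset mset_map)
qed

lemma mset_map_remove_nth:
  assumes "k < length xs"
  shows "mset (map (\<lambda>l. f (xs ! l)) (filter (\<lambda>l. l \<noteq> k) [0..<length xs])) = mset (map f xs) - {#f (xs ! k)#}"
proof -
  have "map (\<lambda>l. f (xs ! l)) [0..<length xs] = map f xs"
    by (rule nth_equalityI) auto
  then show ?thesis
    using mset_map_filter_upt_neq[OF assms, of "\<lambda>l. f (xs ! l)"] by (metis add_mset_remove_trivial)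
qed

lemma trunk_child_leaf:
  assumes "k < length ps"
  shows "trunk {[k]} (PNode i ps) = Node i (mset (map tree_of ps) - {#tree_of (ps ! k)#})"
proof -
  have "component {[k]} [l] (ps ! l) = tree_of (ps ! l)" for l
    by (rule component_unaffected) (auto simp: strict_prefix_def prefix_def)
  moreover have "mset (map (\<lambda>l. tree_of (ps ! l)) (filter (\<lambda>l. l \<noteq> k) [0..<length ps])) =
     mset (map tree_of ps) - {#tree_of (ps ! k)#}"
    by (rule mset_map_remove_nth[OF assms])
  ultimately show ?thesis
    by (simp add: trunk_def)
qed

lemma trunk_child_deeper:
  assumes "k < length ps" "u \<noteq> []"
  shows "trunk {k # u} (PNode i ps) =
    Node i (add_mset (trunk {u} (ps ! k)) (mset (map tree_of ps) - {#tree_of (ps ! k)#}))"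
proof -
  let ?f = "\<lambda>l. component {k # u} [l] (ps ! l)"
  have un: "?f l = tree_of (ps ! l)" if "l \<noteq> k" for l
    by (rule component_unaffected) (use that in \<open>auto simp: strict_prefix_def prefix_def\<close>)
  have "trunk {k # u} (PNode i ps) = Node i (mset (map ?f [0..<length ps]))"
    using assms by (simp add: trunk_def)
  also have "mset (map ?f [0..<length ps]) = add_mset (?f k) (mset (map ?f (filter (\<lambda>l. l \<noteq> k) [0..<length ps])))"
    by (rule mset_map_filter_upt_neq[OF assms(1), symmetric])
  also have "map ?f (filter (\<lambda>l. l \<noteq> k) [0..<length ps]) = map (\<lambda>l. tree_of (ps ! l)) (filter (\<lambda>l. l \<noteq> k) [0..<length ps])"
    by (rule map_cong) (auto simp: un)
  also have "mset (map (\<lambda>l. tree_of (ps ! l)) (filter (\<lambda>l. l \<noteq> k) [0..<length ps])) =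
     mset (map tree_of ps) - {#tree_of (ps ! k)#}"
    by (rule mset_map_remove_nth[OF assms(1)])
  finally show ?thesis by (simp add: component_Cons trunk_def)
qed

lemma edges_PNode:
  "edges (PNode i ps) = (\<Union>k\<in>{..<length ps}. (#) k ` (insert [] (edges (ps ! k))))"
  by (auto simp: edges_def)

lemma sum_nth_eq_sum_mset: "(\<Sum>k<length ps. f (ps ! k)) = (\<Sum>x\<in>#mset ps. f x)"
proof -
  have "(\<Sum>x\<in>#mset ps. f x) = sum_list (map f ps)"
    by (metis mset_map sum_mset_sum_list)
  then show ?thesis by (simp add: sum_list_sum_nth atLeast0LessThan)
qed

lemma mset_set_UN_disjoint:
  assumes "finite A" "\<And>k. k \<in> A \<Longrightarrow> finite (V k)" "disjoint_family_on V A"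
  shows "mset_set (\<Union>k\<in>A. V k) = (\<Sum>k\<in>A. mset_set (V k))"
  using assms
proof (induction A rule: finite_induct)
  case (insert k A)
  have "V k \<inter> (\<Union>k\<in>A. V k) = {}"
    using insert by (fastforce simp: disjoint_family_on_def)
  moreover have "mset_set (\<Union>k\<in>A. V k) = (\<Sum>k\<in>A. mset_set (V k))"
    using insert by (intro insert.IH) (auto simp: disjoint_family_on_def)
  ultimately show ?case using insert by (simp add: mset_set_Union)
qed simp

lemma image_mset_sum_set: "image_mset f (\<Sum>k\<in>A. M k) = (\<Sum>k\<in>A. image_mset f (M k))"
  by (induction A rule: infinite_finite_induct) auto

text \<open>The first index of an address names the child containing the leaf: the leaf is this
  child itself or lies strictly inside it. Apart from the recursive call, the right-hand side sees
  the children only through their unordered trees, which prepares the independence of the plane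
  representative.\<close>

lemma leaf_deletions_PNode:
  "leaf_deletions j (PNode i ps) =
     (\<Sum>x\<in>#mset ps. (if x = PNode j [] then {#Node i (mset (map tree_of ps) - {#tree_of x#})#} else {#})
       + image_mset (\<lambda>s. Node i (add_mset s (mset (map tree_of ps) - {#tree_of x#}))) (leaf_deletions j x))"
    (is "_ = (\<Sum>x\<in>#_. ?g x)")
proof -
  define V where "V k = {v \<in> (#) k ` (insert [] (edges (ps ! k))). subtree_at (PNode i ps) v = PNode j []}" for k
  have "{v \<in> edges (PNode i ps). subtree_at (PNode i ps) v = PNode j []} = (\<Union>k\<in>{..<length ps}. V k)"
    unfolding edges_PNode V_def by blast
  moreover have "mset_set (\<Union>k\<in>{..<length ps}. V k) = (\<Sum>k<length ps. mset_set (V k))"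
    by (rule mset_set_UN_disjoint) (auto simp: V_def disjoint_family_on_def)
  ultimately have "leaf_deletions j (PNode i ps) =
      (\<Sum>k<length ps. image_mset (\<lambda>v. trunk {v} (PNode i ps)) (mset_set (V k)))"
    by (simp add: leaf_deletions_def image_mset_sum_set)
  also have "\<dots> = (\<Sum>k<length ps. ?g (ps ! k))"
  proof (rule sum.cong, rule refl)
    fix k assume k: "k \<in> {..<length ps}"
    define W where "W = {u \<in> edges (ps ! k). subtree_at (ps ! k) u = PNode j []}"
    have W: "[] \<notin> W" "finite W" by (auto simp: W_def edges_def)
    have nk: "[k] \<notin> (#) k ` W" using W by auto
    have "V k = (if ps ! k = PNode j [] then {[k]} else {}) \<union> (#) k ` W"
      by (auto simp: V_def W_def)
    then have "mset_set (V k) = (if ps ! k = PNode j [] then {#[k]#} else {#}) + mset_set ((#) k ` W)"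
      using W nk by simp
    also have "mset_set ((#) k ` W) = image_mset ((#) k) (mset_set W)"
      by (rule image_mset_mset_set[symmetric]) simp
    finally have "image_mset (\<lambda>v. trunk {v} (PNode i ps)) (mset_set (V k)) =
      (if ps ! k = PNode j [] then {#Node i (mset (map tree_of ps) - {#tree_of (ps ! k)#})#} else {#})
      + image_mset (\<lambda>u. trunk {k # u} (PNode i ps)) (mset_set W)"
      using k by (simp add: trunk_child_leaf multiset.map_comp o_def)
    also have "image_mset (\<lambda>u. trunk {k # u} (PNode i ps)) (mset_set W) =
       image_mset (\<lambda>u. Node i (add_mset (trunk {u} (ps ! k)) (mset (map tree_of ps) - {#tree_of (ps ! k)#}))) (mset_set W)"
      using k W by (intro image_mset_cong trunk_child_deeper) auto
    also have "\<dots> = image_mset (\<lambda>s. Node i (add_mset s (mset (map tree_of ps) - {#tree_of (ps ! k)#}))) (leaf_deletions j (ps ! k))"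
      by (simp add: leaf_deletions_def W_def multiset.map_comp o_def)
    finally show "image_mset (\<lambda>v. trunk {v} (PNode i ps)) (mset_set (V k)) = ?g (ps ! k)" .
  qed
  also have "\<dots> = (\<Sum>x\<in>#mset ps. ?g x)" by (rule sum_nth_eq_sum_mset)
  finally show ?thesis .
qed

text \<open>The representative is the one chosen in \<open>tree_coproduct\<close>, so that
  \<open>lookup_cut_coproduct\<close> applies to it directly.\<close>

definition tree_leaf_deletions :: "'i \<Rightarrow> 'i tree \<Rightarrow> 'i tree multiset" where
  "tree_leaf_deletions j t = leaf_deletions j (SOME p. tree_of p = t)"

lemma ex_tree_of: "\<exists>p. tree_of p = t"
proof (induction t)
  case (Node i G)
  obtain gs where gs: "G = mset gs" using ex_mset[of G] by blast
  obtain f where "\<And>t. t \<in> set gs \<Longrightarrow> tree_of (f t) = t"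
    using Node unfolding gs by (metis set_mset_mset)
  then have "map (tree_of \<circ> f) gs = gs"
    by (intro map_idI) auto
  then have "tree_of (PNode i (map f gs)) = Node i G"
    by (simp only: gs tree_of.simps map_map)
  then show ?case by blast
qed

lemma tree_of_eq_leaf [simp]: "tree_of p = Node j {#} \<longleftrightarrow> p = PNode j []"
  by (cases p) auto

lemma leaf_deletions_eq_sum:
  assumes "\<And>x. x \<in> set ps \<Longrightarrow> leaf_deletions j x = tree_leaf_deletions j (tree_of x)"
  shows "leaf_deletions j (PNode i ps) =
     (let G = mset (map tree_of ps) in
     (\<Sum>s\<in>#G. (if s = leaf j then {#Node i (G - {#s#})#} else {#})
       + image_mset (\<lambda>s'. Node i (add_mset s' (G - {#s#}))) (tree_leaf_deletions j s)))"
proof -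
  let ?G = "mset (map tree_of ps)"
  let ?h = "\<lambda>s D. (if s = leaf j then {#Node i (?G - {#s#})#} else {#})
       + image_mset (\<lambda>s'. Node i (add_mset s' (?G - {#s#}))) D"
  have "leaf_deletions j (PNode i ps) = (\<Sum>x\<in>#mset ps. ?h (tree_of x) (tree_leaf_deletions j (tree_of x)))"
    unfolding leaf_deletions_PNode
    by (intro arg_cong[of _ _ sum_mset] image_mset_cong) (simp only: tree_of_eq_leaf assms set_mset_mset)
  also have "\<dots> = (\<Sum>s\<in>#?G. ?h s (tree_leaf_deletions j s))"
    unfolding mset_map multiset.map_comp o_def by (rule refl)
  finally show ?thesis by (simp only: Let_def)
qed

lemma leaf_deletions_eq: "leaf_deletions j p = tree_leaf_deletions j (tree_of p)"
proof -
  \<comment> \<open>Two arbitrary representatives of the same unordered tree are compared. By the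
    induction hypothesis each child may be replaced by its chosen representative, and then both
    sides are the same sum over \<open>G\<close>.\<close>
  have "\<forall>p q. tree_of p = t \<longrightarrow> tree_of q = t \<longrightarrow> leaf_deletions j p = leaf_deletions j q" for t
  proof (induction t)
    case (Node i G)
    have *: "leaf_deletions j x = tree_leaf_deletions j (tree_of x)" if "tree_of x \<in># G" for x
      using Node[OF that] someI_ex[OF ex_tree_of[of "tree_of x"]] unfolding tree_leaf_deletions_def by blast
    have "leaf_deletions j p = (\<Sum>s\<in>#G. (if s = leaf j then {#Node i (G - {#s#})#} else {#})
       + image_mset (\<lambda>s'. Node i (add_mset s' (G - {#s#}))) (tree_leaf_deletions j s))"
      if p: "tree_of p = Node i G" for p
    proof -
      obtain ps where ps: "p = PNode i ps" "mset (map tree_of ps) = G"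
        using p by (cases p) auto
      then have "leaf_deletions j x = tree_leaf_deletions j (tree_of x)" if "x \<in> set ps" for x
        using * that by auto
      from leaf_deletions_eq_sum[of ps j, where i = i, OF this] show ?thesis
        by (simp only: ps Let_def)
    qed
    then show ?case by simp
  qed
  then show ?thesis
    using someI_ex[OF ex_tree_of[of "tree_of p"]] unfolding tree_leaf_deletions_def by blast
qed

lemma tree_leaf_deletions_Node:
  "tree_leaf_deletions j (Node i G) =
     (\<Sum>s\<in>#G. (if s = leaf j then {#Node i (G - {#s#})#} else {#})
       + image_mset (\<lambda>s'. Node i (add_mset s' (G - {#s#}))) (tree_leaf_deletions j s))"
proof -
  obtain p where p: "tree_of p = Node i G" using ex_tree_of by blast
  then obtain ps where ps: "p = PNode i ps" "mset (map tree_of ps) = G"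
    by (cases p) auto
  have "tree_leaf_deletions j (Node i G) = leaf_deletions j (PNode i ps)"
    using leaf_deletions_eq[of j p] p ps(1) by (simp only:)
  then show ?thesis
    using leaf_deletions_eq_sum[of ps j, where i = i, OF leaf_deletions_eq] by (simp only: ps Let_def)
qed

lemma forest_degree_remove:
  "s \<in># G \<Longrightarrow> num_vertices s + forest_degree (G - {#s#}) = forest_degree G"
  by (metis forest_degree_add_mset insert_DiffM)

lemma in_tree_leaf_deletions:
  "t' \<in># tree_leaf_deletions j t \<Longrightarrow> root_label t' = root_label t \<and> num_vertices t = Suc (num_vertices t')"
proof (induction t arbitrary: t')
  case (Node i G)
  have *: "forest_degree G = num_vertices s + forest_degree (G - {#s#})" if "s \<in># G" for s
    by (simp only: forest_degree_remove[OF that])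
  from Node.prems obtain s where s: "s \<in># G"
    and "t' \<in># (if s = leaf j then {#Node i (G - {#s#})#} else {#})
      + image_mset (\<lambda>s'. Node i (add_mset s' (G - {#s#}))) (tree_leaf_deletions j s)"
    unfolding tree_leaf_deletions_Node by auto
  then consider "s = leaf j" "t' = Node i (G - {#s#})"
    | s' where "s' \<in># tree_leaf_deletions j s" "t' = Node i (add_mset s' (G - {#s#}))"
    by (auto split: if_splits)
  then show ?case
  proof cases
    case 1
    then show ?thesis
      unfolding num_vertices_Node *[OF s] by (simp add: num_vertices_Node del: num_vertices.simps)
  next
    case 2
    then show ?thesis
      using Node.IH[OF s 2(1)] unfolding num_vertices_Node *[OF s]
      by (simp add: num_vertices_Node del: num_vertices.simps)
  qed
qed

text \<open>Each cut edge contributes one tree to the pruned part, so a one-tree pruned part forces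
  a cut with one edge. Conversely, a single edge is always admissible.\<close>

lemma cuts_single_leaf:
  "{c \<in> admissible_cuts p. pruned_part c p = {#leaf j#} \<and> trunk c p = t'} =
   (\<lambda>v. {v}) ` {v \<in> edges p. subtree_at p v = PNode j [] \<and> trunk {v} p = t'}"
proof (intro equalityI subsetI)
  have comp: "component {v} v q = tree_of q" for v and q :: "'a plane_tree"
    by (rule component_unaffected) auto
  { fix c assume c: "c \<in> {c \<in> admissible_cuts p. pruned_part c p = {#leaf j#} \<and> trunk c p = t'}"
    then have "size (pruned_part c p) = 1" by auto
    then have "card c = 1" by (simp add: pruned_part_def)
    then obtain v where v: "c = {v}" by (auto simp: card_1_singleton_iff)
    show "c \<in> (\<lambda>v. {v}) ` {v \<in> edges p. subtree_at p v = PNode j [] \<and> trunk {v} p = t'}"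
      using c by (auto simp: v pruned_part_def comp admissible_cuts_def) }
  { fix c assume "c \<in> (\<lambda>v. {v}) ` {v \<in> edges p. subtree_at p v = PNode j [] \<and> trunk {v} p = t'}"
    then obtain v where v: "c = {v}" "v \<in> edges p" "subtree_at p v = PNode j []" "trunk {v} p = t'"
      by blast
    have "card (path_edges w \<inter> {v}) \<le> 1" for w
      by (rule order_trans[OF card_mono[of "{v}"]]) auto
    then show "c \<in> {c \<in> admissible_cuts p. pruned_part c p = {#leaf j#} \<and> trunk c p = t'}"
      using v by (auto simp: admissible_cuts_def pruned_part_def comp) }
qed

lemma finite_admissible_cuts [simp]: "finite (admissible_cuts p)"
  by (rule finite_subset[of _ "Pow (edges p)"]) (auto simp: admissible_cuts_def)

lemma lookup_cut_coproduct:
  "Poly_Mapping.lookup (cut_coproduct p :: ('i, 'k::comm_ring_1) ck_tensor) ({#leaf j#}, {#t'#}) =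
     of_nat (count (leaf_deletions j p) t')"
proof -
  have "Poly_Mapping.lookup (cut_coproduct p :: ('i, 'k) ck_tensor) ({#leaf j#}, {#t'#}) =
    (\<Sum>c\<in>admissible_cuts p. if pruned_part c p = {#leaf j#} \<and> trunk c p = t' then 1 else 0)"
    by (simp add: cut_coproduct_def lookup_sum lookup_single when_def)
  also have "\<dots> = of_nat (card {c \<in> admissible_cuts p. pruned_part c p = {#leaf j#} \<and> trunk c p = t'})"
    by (simp add: sum.If_cases Int_def)
  also have "card {c \<in> admissible_cuts p. pruned_part c p = {#leaf j#} \<and> trunk c p = t'} =
      card {v \<in> edges p. subtree_at p v = PNode j [] \<and> trunk {v} p = t'}"
    unfolding cuts_single_leaf by (rule card_image) auto
  also have "\<dots> = count (leaf_deletions j p) t'"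
    by (auto simp: leaf_deletions_def count_image_mset Int_def intro!: arg_cong[of _ _ card])
  finally show ?thesis .
qed

lemma lookup_tree_coproduct:
  "Poly_Mapping.lookup (tree_coproduct t :: ('i, 'k::comm_ring_1) ck_tensor) ({#leaf j#}, {#t'#}) =
     of_nat (count (tree_leaf_deletions j t) t')"
  by (simp add: tree_coproduct_def lookup_add lookup_single lookup_cut_coproduct tree_leaf_deletions_def)

lemma lookup_single_zero_mult:
  "Poly_Mapping.lookup (Poly_Mapping.single ({#}, {#}) c * (z :: ('i, 'k::comm_ring_1) ck_tensor)) k
     = c * Poly_Mapping.lookup z k"
proof -
  have "Poly_Mapping.single ({#}, {#}) c * z = Poly_Mapping.map ((*) c) z"
    using mult_map_scale_conv_mult[of c z] by (simp add: zero_prod_def)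
  then show ?thesis by (simp add: map.rep_eq when_def)
qed

section \<open>Taylor coefficients\<close>

text \<open>The multi-index factorial; for a forest it counts the permutations of equal trees among
  themselves.\<close>

definition mset_fact :: "'a multiset \<Rightarrow> 'k::field_char_0" where
  "mset_fact m = (\<Prod>a\<in>set_mset m. fact (count m a))"

lemma mset_fact_empty [simp]: "mset_fact {#} = 1"
  by (simp add: mset_fact_def)

lemma mset_fact_add_mset:
  "mset_fact (add_mset a m) = (of_nat (Suc (count m a)) * mset_fact m :: 'k::field_char_0)"
proof (cases "a \<in># m")
  case True
  have *: "(\<Prod>x\<in>set_mset m. fact (count m x)) = fact (count m a) * (\<Prod>x\<in>set_mset m - {a}. fact (count m x) :: 'k)"
    using True by (simp add: prod.remove)
  have "mset_fact (add_mset a m) = (fact (Suc (count m a)) :: 'k) * (\<Prod>x\<in>set_mset m - {a}. fact (count (add_mset a m) x))"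
    using True unfolding mset_fact_def by (simp add: insert_absorb prod.remove)
  also have "(\<Prod>x\<in>set_mset m - {a}. fact (count (add_mset a m) x) :: 'k) = (\<Prod>x\<in>set_mset m - {a}. fact (count m x))"
    by (rule prod.cong) auto
  finally show ?thesis unfolding mset_fact_def * by (simp add: algebra_simps)
next
  case False
  then have "(\<Prod>x\<in>set_mset m. fact (count (add_mset a m) x)) = (\<Prod>x\<in>set_mset m. fact (count m x) :: 'k)"
    by (intro prod.cong) auto
  with False show ?thesis
    by (simp add: mset_fact_def not_in_iff)
qed

lemma mset_fact_nonzero [simp]: "mset_fact m \<noteq> 0"
  by (simp add: mset_fact_def)

lemma mset_fact_remove: "a \<in># m \<Longrightarrow> mset_fact m = of_nat (count m a) * mset_fact (m - {#a#})"
  using mset_fact_add_mset[of a "m - {#a#}"] by (simp add: Suc_diff_Suc)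

text \<open>The partial derivative of \<open>f\<close> at 0 along \<open>m\<close>. This
  normalization keeps factorials out of the recurrences.\<close>

definition taylor :: "('a, 'k::field_char_0) mps \<Rightarrow> 'a multiset \<Rightarrow> 'k" where
  "taylor f m = mset_fact m * coeff f m"

lemma sum_mset_eq_sum_count:
  assumes "finite A" "set_mset M \<subseteq> A"
  shows "(\<Sum>x\<in>#M. f x) = (\<Sum>x\<in>A. of_nat (count M x) * f x :: 'k::semiring_1)"
  using assms(2)
proof (induction M)
  case (add y M)
  have "(\<Sum>x\<in>A. of_nat (count (add_mset y M) x) * f x) = (\<Sum>x\<in>A. (if x = y then f x else 0) + of_nat (count M x) * f x)"
    by (intro sum.cong) (auto simp: algebra_simps)
  also have "\<dots> = f y + (\<Sum>x\<in>A. of_nat (count M x) * f x)"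
    using add.prems assms(1) by (simp add: sum.distrib sum.delta)
  finally show ?case using add by simp
qed simp

text \<open>Only splittings into one element \<open>s\<close> and the rest survive. Passing from the
  factorial of \<open>m\<close> to that of the rest costs \<open>count m s\<close>, which turns the
  sum over distinct elements into one over the multiset.\<close>

lemma taylor_mult_linear:
  assumes "\<And>m. size m \<noteq> 1 \<Longrightarrow> coeff f m = 0"
  shows "taylor (f * g) m = (\<Sum>s\<in>#m. coeff f {#s#} * taylor g (m - {#s#}))"
proof -
  let ?h = "\<lambda>s. ({#s#}, m - {#s#})"
  have "coeff (f * g) m = (\<Sum>(a, b) \<in> ?h ` set_mset m. coeff f a * coeff g b)"
    unfolding coeff_mult
  proof (rule sum.mono_neutral_right)
    show "\<forall>p\<in>{(a, b). a + b = m} - ?h ` set_mset m. (case p of (a, b) \<Rightarrow> coeff f a * coeff g b) = 0"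
    proof
      fix p assume p: "p \<in> {(a, b). a + b = m} - ?h ` set_mset m"
      obtain a b where ab: "p = (a, b)" by (cases p)
      have "a \<noteq> {#s#}" for s
      proof
        assume "a = {#s#}"
        then have "p = ?h s" "s \<in># m" using p by (auto simp: ab)
        then show False using p by blast
      qed
      then have "size a \<noteq> 1" by (metis size_1_singleton_mset)
      then show "(case p of (a, b) \<Rightarrow> coeff f a * coeff g b) = 0" by (simp add: ab assms)
    qed
  qed auto
  also have "\<dots> = (\<Sum>s\<in>set_mset m. coeff f {#s#} * coeff g (m - {#s#}))"
    by (subst sum.reindex) (auto simp: inj_on_def)
  finally have "taylor (f * g) m = (\<Sum>s\<in>set_mset m. mset_fact m * (coeff f {#s#} * coeff g (m - {#s#})))"
    by (simp add: taylor_def sum_distrib_left)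
  also have "\<dots> = (\<Sum>s\<in>set_mset m. of_nat (count m s) * (coeff f {#s#} * taylor g (m - {#s#})))"
    by (intro sum.cong refl) (simp add: mset_fact_remove taylor_def)
  also have "\<dots> = (\<Sum>s\<in>#m. coeff f {#s#} * taylor g (m - {#s#}))"
    by (rule sum_mset_eq_sum_count[symmetric]) auto
  finally show ?thesis .
qed

lemma taylor_one: "taylor 1 m = (if m = {#} then 1 else 0)"
  by (simp add: taylor_def one_mps_def)

lemma prod_mset_remove: "s \<in># G \<Longrightarrow> f s * (\<Prod>x\<in>#G - {#s#}. f x) = (\<Prod>x\<in>#G. f x)"
  by (metis image_mset_add_mset insert_DiffM prod_mset.add_mset)

text \<open>Each \<open>solution F a\<close> consists of single trees with root \<open>a\<close>, so
  expanding the product distributes the trees of \<open>G\<close> over the factors. With the trees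
  regarded as distinguishable, there are \<open>mset_fact m\<close> ways to do so.\<close>

lemma taylor_prod_solution:
  fixes F :: "'i \<Rightarrow> ('i, 'k::field_char_0) mps"
  shows "taylor (\<Prod>a\<in>#m. solution F a) G =
    (if image_mset root_label G = m then mset_fact m * (\<Prod>s\<in>#G. tree_coeff F s) else 0)"
proof (induction m arbitrary: G)
  case empty
  show ?case by (auto simp: taylor_one)
next
  case (add a m)
  have "taylor (\<Prod>a\<in>#add_mset a m. solution F a) G =
     (\<Sum>s\<in>#G. coeff (solution F a) {#s#} * taylor (\<Prod>a\<in>#m. solution F a) (G - {#s#}))"
    by (simp add: taylor_mult_linear coeff_solution_neq_single)
  also have "\<dots> = (\<Sum>s\<in>#G. if root_label s = a then
      (if image_mset root_label G = add_mset a m then mset_fact m * (\<Prod>s\<in>#G. tree_coeff F s) else 0) else 0)"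
  proof (intro arg_cong[of _ _ sum_mset] image_mset_cong)
    fix s assume s: "s \<in># G"
    have "image_mset root_label (G - {#s#}) = m \<longleftrightarrow> image_mset root_label G = add_mset (root_label s) m"
      using s by (auto simp: image_mset_Diff insert_DiffM2 dest: multi_member_split)
    then show "coeff (solution F a) {#s#} * taylor (\<Prod>a\<in>#m. solution F a) (G - {#s#}) =
      (if root_label s = a then
      (if image_mset root_label G = add_mset a m then mset_fact m * (\<Prod>s\<in>#G. tree_coeff F s) else 0) else 0)"
      by (simp add: coeff_solution_single add.IH prod_mset_remove[OF s, symmetric])
  qed
  also have "\<dots> = (\<Sum>r\<in>#image_mset root_label G. if r = a then
      (if image_mset root_label G = add_mset a m then mset_fact m * (\<Prod>s\<in>#G. tree_coeff F s) else 0) else 0)"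
    by (simp add: multiset.map_comp o_def)
  also have "\<dots> = (if image_mset root_label G = add_mset a m then mset_fact (add_mset a m) * (\<Prod>s\<in>#G. tree_coeff F s) else 0)"
    unfolding sum_mset_delta by (simp add: mset_fact_add_mset algebra_simps)
  finally show ?case .
qed

text \<open>In the fixed-point equation the only monomial of \<open>F i\<close> that can produce the
  forest \<open>G\<close> is the multiset of its roots.\<close>

lemma tree_coeff_Node_eq:
  fixes F :: "'i \<Rightarrow> ('i, 'k::field_char_0) mps"
  shows "mset_fact G * tree_coeff F (Node i G) =
    taylor (F i) (image_mset root_label G) * (\<Prod>s\<in>#G. tree_coeff F s)"
proof -
  let ?r = "image_mset root_label G"
  have "coeff (\<Prod>a\<in>#m. solution F a) G = taylor (\<Prod>a\<in>#m. solution F a) G / mset_fact G" for m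
    by (simp add: taylor_def)
  then have c: "coeff (\<Prod>a\<in>#m. solution F a) G =
      (if ?r = m then mset_fact m * (\<Prod>s\<in>#G. tree_coeff F s) / mset_fact G else 0)" for m
    by (simp add: taylor_prod_solution)
  have "tree_coeff F (Node i G) = Sum_any (\<lambda>m. coeff (F i) m * coeff (\<Prod>a\<in>#m. solution F a) G)"
    by (simp add: tree_coeff_Node mps_subst_def)
  also have "\<dots> = (\<Sum>m\<in>{?r}. coeff (F i) m * coeff (\<Prod>a\<in>#m. solution F a) G)"
    by (rule Sum_any.expand_superset) (auto simp: c)
  finally show ?thesis by (simp add: c taylor_def)
qed

lemma tree_coeff_leaf: "tree_coeff F (leaf j) = coeff (F j) {#}" for F :: "'i \<Rightarrow> ('i, 'k::field_char_0) mps"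
  using tree_coeff_Node_eq[of "{#}" F j] by (simp add: taylor_def)

lemma tree_coeff_eq_0_iff:
  fixes F :: "'i \<Rightarrow> ('i, 'k::field_char_0) mps"
  shows "tree_coeff F (Node i G) = 0 \<longleftrightarrow>
    taylor (F i) (image_mset root_label G) = 0 \<or> (\<exists>s\<in>#G. tree_coeff F s = 0)"
proof -
  have "tree_coeff F (Node i G) = 0 \<longleftrightarrow> mset_fact G * tree_coeff F (Node i G) = 0"
    by simp
  then show ?thesis
    unfolding tree_coeff_Node_eq by (auto simp: prod_mset_zero_iff)
qed

section \<open>The Hopf condition as an eigenvalue property of leaf deletion\<close>

lemma finite_trees_eq [simp]: "finite {t :: 'i::finite tree. num_vertices t = n}"
  by (rule finite_subset[OF _ finite_trees[of n]]) auto

text \<open>The homogeneous parts of the solution lie in the algebra, so their coproducts lie in its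
  tensor square. With the left factor fixed to \<open>leaf j\<close>, the linear part on the right
  is, for each root and degree, a multiple of the solution; \<open>\<Lambda>\<close> is this
  multiple.\<close>

lemma hopf_sdse_leaf_deletions:
  fixes F :: "'i::finite \<Rightarrow> ('i, 'k::field_char_0) mps"
  assumes "hopf_sdse F"
  shows "\<exists>\<Lambda>. \<forall>t'. (\<Sum>t | num_vertices t = Suc (num_vertices t').
      tree_coeff F t * of_nat (count (tree_leaf_deletions j t) t')) =
      \<Lambda> (root_label t') (num_vertices t') * tree_coeff F t'"
proof -
  let ?P = "\<lambda>i n c. \<forall>t'. root_label t' = i \<and> num_vertices t' = n \<longrightarrow>
     (\<Sum>t | num_vertices t = Suc n. tree_coeff F t * of_nat (count (tree_leaf_deletions j t) t')) = c * tree_coeff F t'"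
  have *: "\<exists>c. ?P i n c" for i n
  proof -
    let ?T = "{t :: 'i tree. num_vertices t = Suc n}"
    define x where "x = homogeneous_part (Suc n) (solution F i)"
    have "x \<in> sdse_algebra F"
      unfolding sdse_algebra_def generated_subalgebra_def x_def by blast
    then have "coproduct x \<in> tensor_square (sdse_algebra F)"
      using assms unfolding hopf_sdse_def hopf_subalgebra_def by blast
    from tensor_square_sdse_algebra_linear_part[OF this]
    obtain c where c: "\<And>t'. root_label t' = i \<and> num_vertices t' = n \<Longrightarrow>
        Poly_Mapping.lookup (coproduct x) ({#leaf j#}, {#t'#}) = c * tree_coeff F t'"
      by blast
    have "Poly_Mapping.lookup (coproduct x) ({#leaf j#}, {#t'#}) =
       (\<Sum>t\<in>?T. tree_coeff F t * of_nat (count (tree_leaf_deletions j t) t'))"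
      if t': "root_label t' = i" for t'
    proof -
      have "Poly_Mapping.keys x \<subseteq> (\<lambda>t. {#t#}) ` ?T"
        by (auto simp: in_keys_iff x_def lookup_homogeneous_part coeff_solution when_def split: if_splits)
      moreover have "Poly_Mapping.lookup (coproduct x) ({#leaf j#}, {#t'#}) =
        (\<Sum>G\<in>Poly_Mapping.keys x. Poly_Mapping.lookup x G *
           Poly_Mapping.lookup (\<Prod>t\<in>#G. tree_coproduct t) ({#leaf j#}, {#t'#}))"
        by (simp add: coproduct_def lookup_sum lookup_single_zero_mult)
      ultimately have "Poly_Mapping.lookup (coproduct x) ({#leaf j#}, {#t'#}) =
        (\<Sum>G\<in>(\<lambda>t. {#t#}) ` ?T. Poly_Mapping.lookup x G *
           Poly_Mapping.lookup (\<Prod>t\<in>#G. tree_coproduct t) ({#leaf j#}, {#t'#}))"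
        by (simp add: sum.mono_neutral_left in_keys_iff)
      also have "\<dots> = (\<Sum>t\<in>?T. Poly_Mapping.lookup x {#t#} * of_nat (count (tree_leaf_deletions j t) t'))"
        by (subst sum.reindex) (auto simp: inj_on_def lookup_tree_coproduct)
      also have "\<dots> = (\<Sum>t\<in>?T. tree_coeff F t * of_nat (count (tree_leaf_deletions j t) t'))"
      proof (rule sum.cong, rule refl)
        fix t :: "'i tree" assume t: "t \<in> ?T"
        show "Poly_Mapping.lookup x {#t#} * of_nat (count (tree_leaf_deletions j t) t') =
           tree_coeff F t * of_nat (count (tree_leaf_deletions j t) t')"
        \<comment> \<open>The sum runs over trees with any root, but deletions keep the root, so the
          other trees contribute zero.\<close>
        proof (cases "t' \<in># tree_leaf_deletions j t")
          case True
          then have "root_label t = i" using in_tree_leaf_deletions t' by metis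
          then show ?thesis using t
            by (simp add: x_def lookup_homogeneous_part coeff_solution_single)
        qed (simp add: not_in_iff)
      qed
      finally show ?thesis .
    qed
    then show ?thesis using c by (intro exI[of _ c] allI impI) (simp only: conjunct1)
  qed
  have "\<forall>i. \<exists>f. \<forall>n. ?P i n (f n)"
    by (intro allI choice *)
  then have "\<exists>f. \<forall>i n. ?P i n (f i n)"
    by (rule choice)
  then show ?thesis by blast
qed

lemma count_sum_mset: "count (\<Sum>s\<in>#H. M s) y = (\<Sum>s\<in>#H. count (M s) y)"
  by (induction H) auto

lemma count_image_mset_inj: "inj f \<Longrightarrow> count (image_mset f M) (f x) = count M x"
  by (induction M) (auto simp: inj_eq)

text \<open>At most one \<open>s'\<close> satisfies the condition, since adding a tree to a fixed
  \<open>K\<close> is injective. Writing this as a sum over \<open>G\<close> allows it to be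
  exchanged later with the sum over the forests \<open>H\<close>.\<close>

lemma count_image_add_mset:
  "count (image_mset (\<lambda>s'. Node i (add_mset s' K)) M) (Node i G) =
     (\<Sum>s'\<in>set_mset G. if K = G - {#s'#} then count M s' else 0)"
proof (cases "\<exists>s'\<in>#G. K = G - {#s'#}")
  case True
  then obtain s where G: "G = add_mset s K" by (metis insert_DiffM)
  have "count (image_mset (\<lambda>s'. Node i (add_mset s' K)) M) (Node i G) = count M s"
    unfolding G by (rule count_image_mset_inj[of "\<lambda>s. Node i (add_mset s K)"]) (simp add: inj_def)
  moreover have "K = G - {#s'#} \<longleftrightarrow> s' = s" if s': "s' \<in># G" for s'
  proof
    assume "K = G - {#s'#}"
    then have "add_mset s' K = G" using insert_DiffM[OF s'] by (simp only:)
    also note G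
    finally show "s' = s" by simp
  next
    assume "s' = s"
    then show "K = G - {#s'#}" by (simp add: G)
  qed
  then have "(\<Sum>s'\<in>set_mset G. if K = G - {#s'#} then count M s' else 0) =
     (\<Sum>s'\<in>set_mset G. if s' = s then count M s else 0)"
    by (intro sum.cong) auto
  ultimately show ?thesis by (simp add: G)
next
  case False
  have "Node i G \<notin># image_mset (\<lambda>s'. Node i (add_mset s' K)) M"
    using False by auto
  moreover have "(\<Sum>s'\<in>set_mset G. if K = G - {#s'#} then count M s' else 0) = 0"
    using False by (intro sum.neutral) auto
  ultimately show ?thesis unfolding not_in_iff by (simp only:)
qed

text \<open>A forest with a marked tree \<open>s\<close> and remainder \<open>K\<close> is
  determined by \<open>s\<close>, so the double sum collapses.\<close>

lemma sum_forests_remove: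
  fixes \<phi> :: "'i::finite forest \<Rightarrow> 'i tree \<Rightarrow> 'k::comm_monoid_add"
  shows "(\<Sum>H | forest_degree H = N. \<Sum>s\<in>set_mset H. if H - {#s#} = K then \<phi> H s else 0) =
    (\<Sum>s | num_vertices s + forest_degree K = N. \<phi> (add_mset s K) s)"
proof -
  have "(\<Sum>H | forest_degree H = N. \<Sum>s\<in>set_mset H. if H - {#s#} = K then \<phi> H s else 0) =
    (\<Sum>(H, s) \<in> Sigma {H. forest_degree H = N} set_mset. if H - {#s#} = K then \<phi> H s else 0)"
    by (rule sum.Sigma) (auto intro: finite_forests)
  also have "\<dots> = (\<Sum>(H, s) \<in> {(H, s). forest_degree H = N \<and> s \<in># H \<and> H - {#s#} = K}. \<phi> H s)"
    by (rule sum.mono_neutral_cong_right) (auto intro!: finite_SigmaI finite_forests split: if_splits)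
  also have "\<dots> = (\<Sum>s | num_vertices s + forest_degree K = N. \<phi> (add_mset s K) s)"
    by (rule sum.reindex_bij_witness[where i = "\<lambda>s. (add_mset s K, s)" and j = snd])
      (auto simp: forest_degree_remove)
  finally show ?thesis .
qed

text \<open>Deleting a leaf \<open>j\<close> from \<open>Node i H\<close> gives \<open>Node i G\<close> either by removing a child \<open>leaf j\<close> of the
  root (\<open>A\<close> below), or by deleting a leaf from a child \<open>s\<close>, which becomes a child \<open>s'\<close> of the root
  of \<open>Node i G\<close> (\<open>B s'\<close> below); in the second case the eigenvalue property applies to \<open>s'\<close> itself.\<close>

lemma hopf_sdse_recursion:
  fixes F :: "'i::finite \<Rightarrow> ('i, 'k::field_char_0) mps"
  assumes "hopf_sdse F" and norm: "\<And>i. coeff (F i) {#} = 1"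
  shows "\<exists>\<Lambda>. \<forall>i G. (\<forall>s\<in>#G. tree_coeff F s \<noteq> 0) \<longrightarrow>
     taylor (F i) (add_mset j (image_mset root_label G)) =
     (\<Lambda> i (Suc (forest_degree G)) - (\<Sum>s\<in>#G. \<Lambda> (root_label s) (num_vertices s))) *
     taylor (F i) (image_mset root_label G)"
proof -
  obtain \<Lambda> where \<Lambda>: "\<And>t'. (\<Sum>t | num_vertices t = Suc (num_vertices t').
      tree_coeff F t * of_nat (count (tree_leaf_deletions j t) t')) =
      \<Lambda> (root_label t') (num_vertices t') * tree_coeff F t'"
    using hopf_sdse_leaf_deletions[OF assms(1)] by blast
  \<comment> \<open>The coefficient of \<open>Node i H\<close> times the symmetry factor of
    \<open>H\<close>; once the roots are fixed, it is multiplicative in the trees of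
    \<open>H\<close>.\<close>
  define W where "W i H = taylor (F i) (image_mset root_label H) * (\<Prod>s\<in>#H. tree_coeff F s)" for i H
  have W: "mset_fact H * tree_coeff F (Node i H) = W i H" for i H
    by (simp add: W_def tree_coeff_Node_eq)
  \<comment> \<open>The number of copies of \<open>s\<close> in which a leaf may be deleted is
    exactly the quotient of the symmetry factors of \<open>H\<close> and \<open>K\<close>.\<close>
  have W_remove: "mset_fact K * (of_nat (count H s) * tree_coeff F (Node i H)) = W i H"
    if "s \<in># H" "H - {#s#} = K" for H s K i
    unfolding W[symmetric] mset_fact_remove[OF that(1)] that(2) by (simp only: mult_ac)
  \<comment> \<open>A division-free form; the product of the coefficients of the trees of
    \<open>G\<close> is cancelled only at the end.\<close>
  have "W i (add_mset (leaf j) G) + W i G * (\<Sum>s\<in>#G. \<Lambda> (root_label s) (num_vertices s))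
      = \<Lambda> i (Suc (forest_degree G)) * W i G" for i G
  proof -
    let ?N = "Suc (forest_degree G)"
    let ?Hs = "{H :: 'i forest. forest_degree H = ?N}"
    let ?D = "\<lambda>t t'. count (tree_leaf_deletions j t) t'"
    define A where "A = (\<Sum>H\<in>?Hs. \<Sum>s\<in>set_mset H. if H - {#s#} = G then
      (if s = leaf j then mset_fact G * (of_nat (count H s) * tree_coeff F (Node i H)) else 0) else 0)"
    define B where "B s' = (\<Sum>H\<in>?Hs. \<Sum>s\<in>set_mset H. if H - {#s#} = G - {#s'#} then
      mset_fact G * (of_nat (count H s) * tree_coeff F (Node i H)) * of_nat (?D s s') else 0)" for s'
    have D: "of_nat (?D (Node i H) (Node i G)) = (\<Sum>s\<in>set_mset H. of_nat (count H s) *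
        ((if H - {#s#} = G then if s = leaf j then 1 else 0 else 0) +
         (\<Sum>s'\<in>set_mset G. if H - {#s#} = G - {#s'#} then of_nat (?D s s') else 0)) :: 'k)" for H
    proof -
      have "?D (Node i H) (Node i G) = (\<Sum>s\<in>#H. (if H - {#s#} = G then if s = leaf j then 1 else 0 else 0) +
         (\<Sum>s'\<in>set_mset G. if H - {#s#} = G - {#s'#} then ?D s s' else 0))"
        unfolding tree_leaf_deletions_Node count_sum_mset count_union count_image_add_mset
        by (intro arg_cong[of _ _ sum_mset] image_mset_cong) auto
      also have "\<dots> = (\<Sum>s\<in>set_mset H. of_nat (count H s) * ((if H - {#s#} = G then if s = leaf j then 1 else 0 else 0) +
         (\<Sum>s'\<in>set_mset G. if H - {#s#} = G - {#s'#} then ?D s s' else 0)))"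
        by (rule sum_mset_eq_sum_count) auto
      finally show ?thesis
        by (simp add: if_distrib[of of_nat] cong: if_cong)
    qed
    have "\<Lambda> i ?N * W i G = mset_fact G * (\<Sum>t | num_vertices t = Suc (num_vertices (Node i G)).
        tree_coeff F t * of_nat (?D t (Node i G)))"
      unfolding \<Lambda> by (simp add: W[symmetric] num_vertices_Node mult_ac del: num_vertices.simps)
    also have "(\<Sum>t | num_vertices t = Suc (num_vertices (Node i G)). tree_coeff F t * of_nat (?D t (Node i G))) =
      (\<Sum>t\<in>Node i ` ?Hs. tree_coeff F t * of_nat (?D t (Node i G)))"
    proof (rule sum.mono_neutral_right)
      show "\<forall>t\<in>{t. num_vertices t = Suc (num_vertices (Node i G))} - Node i ` ?Hs.
         tree_coeff F t * of_nat (?D t (Node i G)) = 0"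
      proof
        fix t assume t: "t \<in> {t. num_vertices t = Suc (num_vertices (Node i G))} - Node i ` ?Hs"
        obtain i' H where t': "t = Node i' H" by (cases t)
        with t have "i' \<noteq> i" by (auto simp: num_vertices_Node simp del: num_vertices.simps)
        then have "Node i G \<notin># tree_leaf_deletions j t"
          using in_tree_leaf_deletions[of "Node i G" j t] by (auto simp: t')
        then show "tree_coeff F t * of_nat (?D t (Node i G)) = 0" by (simp add: not_in_iff)
      qed
    qed (auto simp: num_vertices_Node simp del: num_vertices.simps)
    also have "\<dots> = (\<Sum>H\<in>?Hs. tree_coeff F (Node i H) * of_nat (?D (Node i H) (Node i G)))"
      by (subst sum.reindex) (auto simp: inj_on_def)
    also have "mset_fact G * \<dots> = A + (\<Sum>s'\<in>set_mset G. B s')"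
    proof -
      have "mset_fact G * (tree_coeff F (Node i H) * of_nat (?D (Node i H) (Node i G))) =
        (\<Sum>s\<in>set_mset H. if H - {#s#} = G then
          (if s = leaf j then mset_fact G * (of_nat (count H s) * tree_coeff F (Node i H)) else 0) else 0)
        + (\<Sum>s'\<in>set_mset G. \<Sum>s\<in>set_mset H. if H - {#s#} = G - {#s'#} then
          mset_fact G * (of_nat (count H s) * tree_coeff F (Node i H)) * of_nat (?D s s') else 0)" for H
        unfolding D sum_distrib_left sum.distrib[symmetric] distrib_left
        by (subst sum.swap, subst sum.distrib[symmetric]) (intro sum.cong refl arg_cong2[of _ _ _ _ "(+)"], auto simp: mult_ac)
      then show ?thesis
        unfolding A_def B_def sum_distrib_left
        by (subst sum.swap) (simp add: sum.distrib)
    qed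
    also have "A = (\<Sum>s | num_vertices s + forest_degree G = ?N. if s = leaf j then W i (add_mset s G) else 0)"
    proof -
      have "A = (\<Sum>H\<in>?Hs. \<Sum>s\<in>set_mset H. if H - {#s#} = G then (if s = leaf j then W i H else 0) else 0)"
        unfolding A_def by (intro sum.cong refl if_cong) (auto simp only: W_remove)
      then show ?thesis by (simp only: sum_forests_remove)
    qed
    also have "\<dots> = W i (add_mset (leaf j) G)"
      by (simp add: sum.delta)
    also have "(\<Sum>s'\<in>set_mset G. B s') =
        (\<Sum>s'\<in>set_mset G. of_nat (count G s') * (W i G * \<Lambda> (root_label s') (num_vertices s')))"
    proof (rule sum.cong, rule refl)
      fix s' assume s': "s' \<in># G"
      let ?K = "G - {#s'#}"
      have G: "G = add_mset s' ?K" using s' by simp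
      have "B s' = (\<Sum>H\<in>?Hs. \<Sum>s\<in>set_mset H. if H - {#s#} = ?K then
          of_nat (count G s') * (W i H * of_nat (?D s s')) else 0)"
        unfolding B_def
      proof (intro sum.cong refl if_cong)
        fix H s assume "s \<in># H" "H - {#s#} = ?K"
        from W_remove[OF this, of i]
        show "mset_fact G * (of_nat (count H s) * tree_coeff F (Node i H)) * of_nat (?D s s') =
            of_nat (count G s') * (W i H * of_nat (?D s s'))"
          unfolding mset_fact_remove[OF s'] by (simp only: mult.assoc)
      qed
      also have "\<dots> = (\<Sum>s | num_vertices s + forest_degree ?K = ?N.
          of_nat (count G s') * (W i (add_mset s ?K) * of_nat (?D s s')))"
        by (rule sum_forests_remove)
      also have "\<dots> = (\<Sum>s | num_vertices s = Suc (num_vertices s').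
          of_nat (count G s') * (W i (add_mset s ?K) * of_nat (?D s s')))"
      proof -
        have "forest_degree G = num_vertices s' + forest_degree ?K"
          using forest_degree_add_mset[of s' ?K] G by metis
        then show ?thesis by simp
      qed
      also have "\<dots> = (\<Sum>s | num_vertices s = Suc (num_vertices s').
          of_nat (count G s') * (taylor (F i) (image_mset root_label G) * (\<Prod>s\<in>#?K. tree_coeff F s) *
          (tree_coeff F s * of_nat (?D s s'))))"
      proof (rule sum.cong, rule refl)
        fix s :: "'i tree"
        show "of_nat (count G s') * (W i (add_mset s ?K) * of_nat (?D s s')) =
          of_nat (count G s') * (taylor (F i) (image_mset root_label G) * (\<Prod>s\<in>#?K. tree_coeff F s) *
          (tree_coeff F s * of_nat (?D s s')))"
        \<comment> \<open>If \<open>s'\<close> arises from \<open>s\<close> by a deletion, their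
          roots agree, so the Taylor coefficient of \<open>F i\<close> is the one at the roots of
          \<open>G\<close>. What still varies with \<open>s\<close> is the sum defining the
          eigenvalue at \<open>s'\<close>.\<close>
        proof (cases "s' \<in># tree_leaf_deletions j s")
          case True
          then have "root_label s = root_label s'" using in_tree_leaf_deletions by metis
          then have "image_mset root_label (add_mset s ?K) = image_mset root_label G"
            by (metis G image_mset_add_mset)
          then show ?thesis by (simp only: W_def image_mset_add_mset prod_mset.add_mset mult_ac)
        qed (simp add: not_in_iff)
      qed
      also have "\<dots> = of_nat (count G s') * (taylor (F i) (image_mset root_label G) * (\<Prod>s\<in>#?K. tree_coeff F s) *
          (\<Lambda> (root_label s') (num_vertices s') * tree_coeff F s'))"
        by (simp only: sum_distrib_left[symmetric] \<Lambda>)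
      also have "\<dots> = of_nat (count G s') * (W i G * \<Lambda> (root_label s') (num_vertices s'))"
        by (simp only: W_def prod_mset_remove[OF s', symmetric] mult_ac)
      finally show "B s' = of_nat (count G s') * (W i G * \<Lambda> (root_label s') (num_vertices s'))" .
    qed
    also have "\<dots> = W i G * (\<Sum>s\<in>#G. \<Lambda> (root_label s) (num_vertices s))"
      by (subst sum_mset_eq_sum_count[of "set_mset G"]) (simp_all add: sum_distrib_left mult_ac)
    finally show ?thesis by simp
  qed
  then have *: "taylor (F i) (add_mset j (image_mset root_label G)) * (\<Prod>s\<in>#G. tree_coeff F s) =
      (\<Lambda> i (Suc (forest_degree G)) - (\<Sum>s\<in>#G. \<Lambda> (root_label s) (num_vertices s))) *
      taylor (F i) (image_mset root_label G) * (\<Prod>s\<in>#G. tree_coeff F s)" for i G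
    by (simp add: W_def tree_coeff_leaf norm algebra_simps)
  show ?thesis
  proof (intro exI allI impI)
    fix i G assume "\<forall>s\<in>#G. tree_coeff F s \<noteq> 0"
    then have "(\<Prod>s\<in>#G. tree_coeff F s) \<noteq> 0" by (auto simp: prod_mset_zero_iff)
    with *[of i G] show "taylor (F i) (add_mset j (image_mset root_label G)) =
      (\<Lambda> i (Suc (forest_degree G)) - (\<Sum>s\<in>#G. \<Lambda> (root_label s) (num_vertices s))) *
      taylor (F i) (image_mset root_label G)" by simp
  qed
qed

section \<open>The recurrence for the Taylor coefficients\<close>

lemma taylor_empty: "taylor f {#} = coeff f {#}"
  by (simp add: taylor_def)

lemma taylor_eqI: "(\<And>m. taylor f m = taylor g m) \<Longrightarrow> f = g"
  by (rule mps_eqI) (simp add: taylor_def)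

lemma sdse_edge_iff_taylor:
  "sdse_edge F i j \<longleftrightarrow> (\<exists>m. taylor (F i) (add_mset j m) \<noteq> 0)"
  for F :: "'i \<Rightarrow> ('i, 'k::field_char_0) mps"
proof -
  have "mps_deriv j (F i) = 0 \<longleftrightarrow> (\<forall>m. coeff (mps_deriv j (F i)) m = coeff 0 m)"
    using mps_eqI[of "mps_deriv j (F i)" 0] by auto
  also have "\<dots> \<longleftrightarrow> (\<forall>m. coeff (F i) (add_mset j m) = 0)"
    using of_nat_neq_0[where 'a = 'k] by (simp add: mps_deriv_def zero_mps_def)
  finally show ?thesis by (simp add: sdse_edge_def taylor_def)
qed

text \<open>Grafting a tree with root \<open>k\<close> below a vertex with an edge to \<open>k\<close> transports the shape
  \<open>\<Lambda> j k n = a k j + (n - 1) b j\<close> along the edges of the graph, and it holds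
  at a self-dependent vertex because of the ladders decorated by this vertex only.\<close>

lemma taylor_recurrence:
  fixes F :: "'i::finite \<Rightarrow> ('i, 'k::field_char_0) mps"
  assumes non_constant: "\<And>i. \<exists>m. m \<noteq> {#} \<and> coeff (F i) m \<noteq> 0"
    and normalized: "\<And>i. coeff (F i) {#} = 1"
    and connected: "connected_sdse F"
    and hopf: "hopf_sdse F"
    and desc: "\<And>j. \<exists>i. self_dependent F i \<and> descendant F i j"
  obtains b where "\<And>k j m. taylor (F k) (add_mset j m) =
      (taylor (F k) {#j#} + (\<Sum>l\<in>#m. b j - taylor (F l) {#j#})) * taylor (F k) m"
    and "\<And>j. \<exists>k. taylor (F k) {#j#} \<noteq> 0"
proof -
  define a where "a i j = taylor (F i) {#j#}" for i j
  have "\<exists>\<Lambda>. \<forall>i G. (\<forall>s\<in>#G. tree_coeff F s \<noteq> 0) \<longrightarrow>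
     taylor (F i) (add_mset j (image_mset root_label G)) =
     (\<Lambda> i (Suc (forest_degree G)) - (\<Sum>s\<in>#G. \<Lambda> (root_label s) (num_vertices s))) *
     taylor (F i) (image_mset root_label G)" for j
    by (rule hopf_sdse_recursion[OF hopf normalized])
  then have "\<forall>j. \<exists>\<Lambda>. \<forall>i G. (\<forall>s\<in>#G. tree_coeff F s \<noteq> 0) \<longrightarrow>
     taylor (F i) (add_mset j (image_mset root_label G)) =
     (\<Lambda> i (Suc (forest_degree G)) - (\<Sum>s\<in>#G. \<Lambda> (root_label s) (num_vertices s))) *
     taylor (F i) (image_mset root_label G)"
    by blast
  from choice[OF this] obtain \<Lambda> where rec: "\<And>j i G. \<forall>s\<in>#G. tree_coeff F s \<noteq> 0 \<Longrightarrow>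
     taylor (F i) (add_mset j (image_mset root_label G)) =
     (\<Lambda> j i (Suc (forest_degree G)) - (\<Sum>s\<in>#G. \<Lambda> j (root_label s) (num_vertices s))) *
     taylor (F i) (image_mset root_label G)"
    by blast
  have leaf: "tree_coeff F (leaf i) = 1" for i
    by (simp add: tree_coeff_leaf normalized)
  have \<Lambda>_1: "\<Lambda> j i 1 = a i j" for i j
    using rec[of "{#}" i j] by (simp add: a_def taylor_empty normalized)
  \<comment> \<open>The trees of \<open>G\<close> are taken to be leaves, with coefficient 1 and
    eigenvalues \<open>a l j\<close>.\<close>
  have corolla: "taylor (F k) (add_mset j m) = (\<Lambda> j k (Suc (size m)) - (\<Sum>l\<in>#m. a l j)) * taylor (F k) m"
    for j k m
  proof -
    have "image_mset root_label (image_mset leaf m) = m"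
      by (simp add: multiset.map_comp o_def)
    moreover have "forest_degree (image_mset leaf m) = size m"
      by (induction m) auto
    moreover have "(\<Sum>s\<in>#image_mset leaf m. \<Lambda> j (root_label s) (num_vertices s)) = (\<Sum>l\<in>#m. a l j)"
      using \<Lambda>_1 by (simp add: multiset.map_comp o_def)
    ultimately show ?thesis
      using rec[of "image_mset leaf m" k j] leaf by simp
  qed
  \<comment> \<open>By \<open>corolla\<close>, a vanishing Taylor coefficient stays zero when
    elements are added. Hence an edge is already visible in the linear term.\<close>
  have down: "taylor (F k) m \<noteq> 0" if "taylor (F k) (m + m') \<noteq> 0" for k m m'
    using that
  proof (induction m')
    case (add x m')
    then show ?case using corolla[of k x "m + m'"] by auto
  qed simp
  have edge: "sdse_edge F i j \<longleftrightarrow> a i j \<noteq> 0" for i j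
  proof
    assume "sdse_edge F i j"
    then obtain m where "taylor (F i) ({#j#} + m) \<noteq> 0" by (auto simp: sdse_edge_iff_taylor)
    then show "a i j \<noteq> 0" unfolding a_def by (rule down)
  next
    assume "a i j \<noteq> 0"
    then show "sdse_edge F i j" by (auto simp: sdse_edge_iff_taylor a_def)
  qed
  have child: "\<exists>l. a k l \<noteq> 0" for k
  proof -
    obtain m where m: "m \<noteq> {#}" "coeff (F k) m \<noteq> 0" using non_constant by blast
    then obtain l m' where "m = add_mset l m'" by (metis multiset_cases)
    with m have "taylor (F k) ({#l#} + m') \<noteq> 0" by (simp add: taylor_def)
    then show ?thesis unfolding a_def using down by blast
  qed
  have graft_nonzero: "tree_coeff F (Node k {#s#}) \<noteq> 0" if "a k (root_label s) \<noteq> 0" "tree_coeff F s \<noteq> 0" for k s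
    using that by (simp add: tree_coeff_eq_0_iff a_def)
  \<comment> \<open>With \<open>G\<close> a single tree, the left-hand side sees only the root of
    \<open>s\<close>. So, if \<open>a k l\<close> is non-zero, the difference of the eigenvalues
    does not depend on the size of \<open>s\<close>.\<close>
  have graft: "taylor (F k) {#j, l#} = (\<Lambda> j k (Suc (num_vertices s)) - \<Lambda> j l (num_vertices s)) * a k l"
    if "root_label s = l" "tree_coeff F s \<noteq> 0" for k j l s
    using rec[of "{#s#}" k j] that by (simp add: a_def)
  \<comment> \<open>Only sizes of trees with non-zero coefficient are constrained, because
    \<open>rec\<close> says nothing about \<open>\<Lambda>\<close> at the others.\<close>
  define P where "P k b \<longleftrightarrow> (\<forall>s j. root_label s = k \<longrightarrow> tree_coeff F s \<noteq> 0 \<longrightarrow>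
      \<Lambda> j k (num_vertices s) = a k j + of_nat (num_vertices s - 1) * b j)" for k b
  have P_self: "\<exists>b. P i b" if "a i i \<noteq> 0" for i
  proof -
    \<comment> \<open>The increment of \<open>\<Lambda> j i\<close> along ladders, as given by
      \<open>graft\<close> with \<open>k = l = i\<close>.\<close>
    define b where "b j = taylor (F i) {#j, i#} / a i i" for j
    have ladder: "\<exists>s. root_label s = i \<and> num_vertices s = Suc n \<and> tree_coeff F s \<noteq> 0" for n
    proof (induction n)
      case 0
      show ?case by (rule exI[of _ "leaf i"]) (simp add: leaf)
    next
      case (Suc n)
      then obtain s where "root_label s = i" "num_vertices s = Suc n" "tree_coeff F s \<noteq> 0" by blast
      with graft_nonzero[of i s] that show ?case
        by (intro exI[of _ "Node i {#s#}"]) simp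
    qed
    have "\<Lambda> j i (Suc n) = a i j + of_nat n * b j" for j n
    proof (induction n)
      case 0
      show ?case using \<Lambda>_1 by simp
    next
      case (Suc n)
      obtain s where s: "root_label s = i" "num_vertices s = Suc n" "tree_coeff F s \<noteq> 0"
        using ladder by blast
      have "b j = \<Lambda> j i (Suc (Suc n)) - \<Lambda> j i (Suc n)"
        using graft[OF s(1,3), of i j] that by (simp add: b_def s(2))
      then show ?case using Suc by (simp add: algebra_simps)
    qed
    then have "P i b" unfolding P_def
      by (metis Suc_diff_1 num_vertices_pos)
    then show ?thesis by blast
  qed
  have P_edge: "P l b" if "P k b" "a k l \<noteq> 0" for k l b
    unfolding P_def
  proof (intro allI impI)
    fix s j assume s: "root_label s = l" "tree_coeff F s \<noteq> 0"
    have 1: "\<Lambda> j k (Suc (num_vertices t)) = a k j + of_nat (num_vertices t) * b j"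
      if t: "root_label t = l" "tree_coeff F t \<noteq> 0" for t
    proof -
      have "tree_coeff F (Node k {#t#}) \<noteq> 0" using graft_nonzero t \<open>a k l \<noteq> 0\<close> by simp
      then show ?thesis using \<open>P k b\<close> unfolding P_def by force
    qed
    \<comment> \<open>Comparing \<open>graft\<close> for \<open>s\<close> and for the single vertex
      \<open>l\<close> transfers the slope from \<open>k\<close> to \<open>l\<close>.\<close>
    have "\<Lambda> j k (Suc (num_vertices s)) - \<Lambda> j l (num_vertices s) = \<Lambda> j k (Suc 1) - a l j"
      using graft[OF s, of k j] graft[of "leaf l" l k j] leaf that(2) \<Lambda>_1 by simp
    then show "\<Lambda> j l (num_vertices s) = a l j + of_nat (num_vertices s - 1) * b j"
      using 1[OF s] 1[of "leaf l"] leaf num_vertices_pos[of s] by (simp add: of_nat_diff algebra_simps)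
  qed
  \<comment> \<open>Every vertex has an outgoing edge, so size 2 is realized by a tree with root
    \<open>k\<close>, and the value there determines the slope.\<close>
  have P_unique: "b = b'" if "P k b" "P k b'" for k b b'
  proof
    fix j
    obtain l where l: "a k l \<noteq> 0" using child by blast
    then have "tree_coeff F (Node k {#leaf l#}) \<noteq> 0" using graft_nonzero leaf by simp
    then have "\<Lambda> j k 2 = a k j + b j" "\<Lambda> j k 2 = a k j + b' j"
      using that unfolding P_def by (force simp: numeral_2_eq_2)+
    then show "b j = b' j" by simp
  qed
  have P_ex: "\<exists>b. P k b" for k
  proof -
    obtain i where i: "self_dependent F i" "descendant F i k" using desc by blast
    obtain b where "P i b" using P_self i(1) edge unfolding self_dependent_def by blast
    have "P k b" using i(2) unfolding descendant_def
      by (induction rule: tranclp_induct) (use \<open>P i b\<close> P_edge edge in blast)+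
    then show ?thesis by blast
  qed
  obtain b where b: "P undefined b" using P_ex by blast
  have P: "P k b" for k
  proof -
    have "equivclp (sdse_edge F) undefined k" using connected unfolding connected_sdse_def by blast
    then show ?thesis
    proof (induction rule: equivclp_induct)
      case base
      show ?case by (rule b)
    next
      case (step y z)
      from step.hyps(2) show ?case
      proof
        assume "sdse_edge F y z"
        then show ?thesis using P_edge step.IH edge by blast
      next
        assume zy: "sdse_edge F z y"
        \<comment> \<open>Against the edge: \<open>z\<close> has some slope function, which passes
          on to \<open>y\<close> and must agree with the one known there.\<close>
        obtain b' where b': "P z b'" using P_ex by blast
        then have "P y b'" using P_edge zy edge by blast
        then show ?thesis using P_unique step.IH b' by blast
      qed
    qed
  qed
  have rec': "taylor (F k) (add_mset j m) =
      (taylor (F k) {#j#} + (\<Sum>l\<in>#m. b j - taylor (F l) {#j#})) * taylor (F k) m" for k j m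
  proof (cases "taylor (F k) m = 0")
    case True
    then show ?thesis using corolla by simp
  next
    case False
    \<comment> \<open>This corolla has non-zero coefficient and realizes the size at which
      \<open>P\<close> is used.\<close>
    define s where "s = Node k (image_mset leaf m)"
    have "image_mset root_label (image_mset leaf m) = m"
      by (simp add: multiset.map_comp o_def)
    then have "tree_coeff F s \<noteq> 0" using False leaf by (auto simp: s_def tree_coeff_eq_0_iff)
    moreover have "num_vertices s = Suc (size m)" by (simp add: s_def multiset.map_comp o_def)
    ultimately have "\<Lambda> j k (Suc (size m)) = a k j + of_nat (size m) * b j"
      using P[of k] unfolding P_def by (force simp: s_def)
    moreover have "(\<Sum>l\<in>#m. b j - a l j) = of_nat (size m) * b j - (\<Sum>l\<in>#m. a l j)"
      by (induction m) (auto simp: algebra_simps)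
    ultimately show ?thesis using corolla[of k j m] by (simp add: a_def)
  qed
  have parent: "\<exists>k. taylor (F k) {#j#} \<noteq> 0" for j
  proof -
    obtain i where "(sdse_edge F)\<^sup>+\<^sup>+ i j" using desc unfolding descendant_def by blast
    then obtain k where "sdse_edge F k j" by (metis tranclp.cases)
    then show ?thesis using edge a_def by metis
  qed
  show thesis by (rule that[OF rec' parent])
qed

section \<open>Blocks of vertices\<close>

text \<open>Blocks are to be indexed by natural numbers, so the classes, as predicates on a finite
  type, are numbered.\<close>

lemma ex_nat_classifier:
  fixes R :: "'i::finite \<Rightarrow> 'i \<Rightarrow> bool"
  assumes "equivp R"
  obtains q :: "'i \<Rightarrow> nat" where "\<And>x y. q x = q y \<longleftrightarrow> R x y"
proof -
  obtain en :: "('i \<Rightarrow> bool) \<Rightarrow> nat" and n where "inj_on en UNIV"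
    using finite_imp_inj_to_nat_seg[of "UNIV :: ('i \<Rightarrow> bool) set"] by auto
  then have "en (R x) = en (R y) \<longleftrightarrow> R x y" for x y
    using assms by (auto simp: equivp_def inj_on_def)
  then show thesis by (intro that[of "\<lambda>x. en (R x)"])
qed

text \<open>Two vertices are equivalent if they are equal or \<open>b j \<noteq> a l j\<close>. In an equivalence class the
  columns of \<open>a\<close> (and of \<open>b\<close>) are proportional, so \<open>\<mu>\<close> can make them equal; the classes with
  label in \<open>S\<close> are those of the self-dependent vertices.\<close>

lemma classification:
  fixes a :: "'i::finite \<Rightarrow> 'i \<Rightarrow> 'k::field" and b :: "'i \<Rightarrow> 'k"
  assumes parent: "\<And>j. \<exists>k. a k j \<noteq> 0"
    and sym_a: "\<And>k l j. (b j - a l j) * a k l = (b l - a j l) * a k j"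
    and sym_b: "\<And>l j. (b j - a l j) * b l = (b l - a j l) * b j"
  obtains q :: "'i \<Rightarrow> nat" and \<beta> :: "nat \<Rightarrow> 'k" and S :: "nat set" and \<mu> :: "'i \<Rightarrow> 'k"
  where "\<And>j. \<mu> j \<noteq> 0"
    and "\<And>x y. \<mu> y * a x y =
      (if q y \<in> S then if q x = q y then 1 else 1 + \<beta> (q y) else if q x = q y then 0 else 1)"
    and "\<And>x y. \<mu> y * (b y - a x y) = (if q x = q y then \<beta> (q y) else 0)"
    and "\<And>y. q y \<notin> S \<Longrightarrow> \<beta> (q y) = 1"
proof -
  define e where "e l j = b j - a l j" for l j
  have a_e: "a l j = b j - e l j" for l j by (simp add: e_def)
  define R where "R l j \<longleftrightarrow> l = j \<or> e l j \<noteq> 0" for l j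
  \<comment> \<open>Multiplying by a non-zero entry of column \<open>l\<close> of \<open>a\<close>
    makes the left-hand side of \<open>sym_a\<close> non-zero, hence both factors on the
    right.\<close>
  have e_sym: "e j l \<noteq> 0" if "e l j \<noteq> 0" for l j
  proof -
    obtain k where "a k l \<noteq> 0" using parent by blast
    with that sym_a[of j l k] show ?thesis by (auto simp: e_def)
  qed
  \<comment> \<open>For distinct \<open>l\<close> and \<open>j\<close> the ratio
    \<open>e l j / e j l\<close> is forced by \<open>sym_a\<close> for the columns of
    \<open>a\<close> and by \<open>sym_b\<close> for \<open>b\<close>.\<close>
  have proportional: "\<exists>r. r \<noteq> 0 \<and> (\<forall>k. e k j = r * e k l) \<and> (\<forall>k. a k j = r * a k l) \<and> b j = r * b l"
    if "R l j" for l j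
  proof (cases "l = j")
    case False
    then have e: "e l j \<noteq> 0" "e j l \<noteq> 0" using that e_sym by (auto simp: R_def)
    define r where "r = e l j / e j l"
    have 1: "a k j = r * a k l" for k
      using sym_a[of j l k] e by (simp add: r_def e_def field_simps)
    have 2: "b j = r * b l"
      using sym_b[of j l] e by (simp add: r_def e_def field_simps)
    have 3: "e k j = r * e k l" for k
      by (simp add: e_def 1[of k] 2 right_diff_distrib)
    have "r \<noteq> 0" using e by (simp add: r_def)
    then show ?thesis using 1 2 3 by blast
  qed (auto intro: exI[of _ 1])
  have R_sym: "R j l" if "R l j" for l j
    using that e_sym by (auto simp: R_def)
  \<comment> \<open>Columns \<open>j\<close> and \<open>l\<close> of \<open>e\<close> are
    proportional, so their entries in row \<open>p\<close> vanish together.\<close>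
  have R_trans: "R l p" if R: "R l j" "R j p" for l j p
  proof (cases "j = p \<or> l = p")
    case False
    then have "e j p \<noteq> 0" using R by (auto simp: R_def)
    then have "e p j \<noteq> 0" by (rule e_sym)
    moreover obtain r where "e p j = r * e p l" using proportional[OF R(1)] by blast
    ultimately have "e p l \<noteq> 0" by auto
    then show ?thesis using e_sym by (auto simp: R_def)
  qed (use R in \<open>auto simp: R_def\<close>)
  have "equivp R"
    by (rule equivpI) (auto simp: reflp_def symp_def transp_def R_sym intro: R_trans, simp add: R_def)
  then obtain q :: "'i \<Rightarrow> nat" where q: "\<And>x y. q x = q y \<longleftrightarrow> R x y"
    by (rule ex_nat_classifier) blast
  \<comment> \<open>Inside a block the columns \<open>x\<close> and \<open>y\<close> of
    \<open>a\<close> and of \<open>e\<close> share one proportionality factor. It cancels from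
    \<open>sym_a\<close>, leaving \<open>e y y = e x y\<close>.\<close>
  have e_eq: "e x y = (if q x = q y then e y y else 0)" for x y
  proof (cases "x = y \<or> \<not> R x y")
    case False
    then have R: "R y x" using R_sym by blast
    obtain r where r: "r \<noteq> 0" "\<And>k. e k x = r * e k y" "\<And>k. a k x = r * a k y"
      using proportional[OF R] by blast
    obtain k where k: "a k y \<noteq> 0" using parent by blast
    have "e y x * a k y = e x y * a k x" unfolding e_def by (rule sym_a)
    then have "r * a k y * e y y = r * a k y * e x y" by (simp only: r mult_ac)
    then have "e y y = e x y" using r(1) k by simp
    then show ?thesis using False by (simp add: q)
  qed (auto simp: q R_def)
  \<comment> \<open>A non-zero diagonal entry is scaled to 1. Otherwise \<open>b y\<close> is scaled
    to 1; it is the common value of column \<open>y\<close> outside its block, where some parent of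
    \<open>y\<close> must lie.\<close>
  define \<mu> where "\<mu> y = (if a y y \<noteq> 0 then 1 / a y y else 1 / b y)" for y
  have b_nonzero: "b y \<noteq> 0" if "a y y = 0" for y
  proof -
    obtain x where "a x y \<noteq> 0" using parent by blast
    then show ?thesis using that a_e[of x y] a_e[of y y] e_eq[of x y] by (auto split: if_splits)
  qed
  \<comment> \<open>From \<open>x\<close> to \<open>y\<close> the entries are scaled by
    \<open>r\<close> and \<open>\<mu>\<close> by its inverse, so these data belong to the block, and
    \<open>\<beta>\<close> may be read off at any representative.\<close>
  have inv: "(a y y = 0 \<longleftrightarrow> a x x = 0) \<and> \<mu> y * e y y = \<mu> x * e x x" if xy: "q x = q y" for x y
  proof -
    obtain r where r: "r \<noteq> 0" "\<And>k. e k y = r * e k x" "\<And>k. a k y = r * a k x" "b y = r * b x"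
      using proportional[of x y] xy q by blast
    have "e y x = e x x" using e_eq[of y x] xy by simp
    then have "a y y = r * a x x" "e y y = r * e x x" "b y = r * b x"
      using r a_e[of x x] a_e[of y x] by auto
    then show ?thesis using r(1) by (auto simp: \<mu>_def)
  qed
  define S where "S = q ` {y. a y y \<noteq> 0}"
  define \<beta> where "\<beta> n = (let y = SOME y. q y = n in \<mu> y * e y y)" for n
  have S: "q y \<in> S \<longleftrightarrow> a y y \<noteq> 0" for y
  proof
    assume "q y \<in> S"
    then obtain x where "q y = q x" "a x x \<noteq> 0" unfolding S_def by blast
    then show "a y y \<noteq> 0" using inv[of y x] by blast
  qed (auto simp: S_def)
  have \<beta>: "\<beta> (q y) = \<mu> y * e y y" for y
  proof -
    have "q (SOME z. q z = q y) = q y" by (rule someI) simp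
    from inv[OF this] show ?thesis unfolding \<beta>_def Let_def by simp
  qed
  show thesis
  proof (rule that)
    show "\<mu> j \<noteq> 0" for j using b_nonzero by (auto simp: \<mu>_def)
    show "\<mu> y * (b y - a x y) = (if q x = q y then \<beta> (q y) else 0)" for x y
      using e_eq[of x y] by (simp add: \<beta> e_def)
    show "\<beta> (q y) = 1" if "q y \<notin> S" for y
      using that S[of y] b_nonzero[of y] by (simp add: \<beta> \<mu>_def e_def)
    show "\<mu> y * a x y =
      (if q y \<in> S then if q x = q y then 1 else 1 + \<beta> (q y) else if q x = q y then 0 else 1)" for x y
    proof -
      have "a x y = (if q x = q y then a y y else b y)"
        using a_e[of x y] a_e[of y y] e_eq[of x y] by auto
      moreover have "\<mu> y * b y = 1 + \<mu> y * e y y" if "a y y \<noteq> 0"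
        using that by (simp add: \<mu>_def e_def field_simps)
      moreover have "\<mu> y * b y = 1" if "a y y = 0"
        using that b_nonzero[of y] by (simp add: \<mu>_def)
      moreover have "\<mu> y * a y y = 1" if "a y y \<noteq> 0"
        using that by (simp add: \<mu>_def)
      ultimately show ?thesis by (auto simp: S \<beta>)
    qed
  qed
qed

section \<open>Products of series in disjoint blocks of variables\<close>

lemma mset_fact_filter:
  "mset_fact m = mset_fact (filter_mset P m) * (mset_fact (filter_mset (\<lambda>x. \<not> P x) m) :: 'k::field_char_0)"
  by (induction m) (auto simp: mset_fact_add_mset)

text \<open>A monomial splits in only one way into variables of \<open>f\<close> and of
  \<open>g\<close>, and its factorial splits along.\<close>

lemma taylor_mult_disjoint:
  assumes f: "\<And>m. \<not> (\<forall>x\<in>#m. P x) \<Longrightarrow> coeff f m = 0" and g: "\<And>m. \<exists>x\<in>#m. P x \<Longrightarrow> coeff g m = 0"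
  shows "taylor (f * g) m = taylor f (filter_mset P m) * taylor g (filter_mset (\<lambda>x. \<not> P x) m)"
proof -
  let ?s = "(filter_mset P m, filter_mset (\<lambda>x. \<not> P x) m)"
  have "coeff (f * g) m = (\<Sum>(a, b)\<in>{?s}. coeff f a * coeff g b)"
    unfolding coeff_mult
  proof (rule sum.mono_neutral_right)
    show "{?s} \<subseteq> {(a, b). a + b = m}" by simp
    show "\<forall>p\<in>{(a, b). a + b = m} - {?s}. (case p of (a, b) \<Rightarrow> coeff f a * coeff g b) = 0"
    proof
      fix p assume p: "p \<in> {(a, b). a + b = m} - {?s}"
      obtain a b where ab: "p = (a, b)" by (cases p)
      have "\<not> (\<forall>x\<in>#a. P x) \<or> (\<exists>x\<in>#b. P x)"
      proof (rule ccontr)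
        assume *: "\<not> ?thesis"
        then have "P x" if "x \<in># a" for x using that by blast
        then have "filter_mset P a = a" "filter_mset (\<lambda>x. \<not> P x) a = {#}"
          by (simp_all add: filter_mset_eq_conv filter_mset_eq_mempty_iff)
        moreover have "\<not> P x" if "x \<in># b" for x using that * by blast
        then have "filter_mset P b = {#}" "filter_mset (\<lambda>x. \<not> P x) b = b"
          by (simp_all add: filter_mset_eq_conv filter_mset_eq_mempty_iff)
        moreover have "m = a + b" using p ab by simp
        ultimately have "p = ?s" by (simp add: ab)
        then show False using p by simp
      qed
      then show "(case p of (a, b) \<Rightarrow> coeff f a * coeff g b) = 0" using f g by (auto simp: ab)
    qed
  qed simp
  then show ?thesis by (simp add: taylor_def mset_fact_filter[of m P])
qed

text \<open>The multinomial theorem, in Taylor normalization.\<close>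

lemma taylor_block_sum_power:
  fixes A :: "'i::finite set"
  defines "B \<equiv> block_sum A :: ('i, 'k::field_char_0) mps"
  shows "taylor (B ^ k) m = (if set_mset m \<subseteq> A \<and> size m = k then fact k else 0)"
proof (induction k arbitrary: m)
  case 0
  show ?case by (auto simp: taylor_one)
next
  case (Suc k)
  have c: "coeff (B) m = (if \<exists>a\<in>A. m = {#a#} then 1 else 0)" for m
  proof -
    have "coeff (B) m = (\<Sum>a\<in>A. if m = {#a#} then 1 else 0)"
      unfolding B_def block_sum_def using finite[of A]
      by (induction A rule: finite_induct) (auto simp: zero_mps_def plus_mps_def mps_var_def)
    also have "\<dots> = (if \<exists>a\<in>A. m = {#a#} then 1 else 0)"
    proof (cases "\<exists>a\<in>A. m = {#a#}")
      case True
      then obtain a where "a \<in> A" "m = {#a#}" by blast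
      then show ?thesis by simp
    qed (simp add: sum.neutral)
    finally show ?thesis .
  qed
  have "taylor (B * B ^ k) m =
     (\<Sum>s\<in>#m. coeff (B) {#s#} * taylor (B ^ k) (m - {#s#}))"
    by (rule taylor_mult_linear) (auto simp: c)
  also have "\<dots> = (\<Sum>s\<in>#m. if set_mset m \<subseteq> A \<and> size m = Suc k then fact k else 0)"
  proof (intro arg_cong[of _ _ sum_mset] image_mset_cong)
    fix s assume "s \<in># m"
    then obtain m' where "m = add_mset s m'" by (metis insert_DiffM)
    then show "coeff (B) {#s#} * taylor (B ^ k) (m - {#s#}) =
       (if set_mset m \<subseteq> A \<and> size m = Suc k then fact k else 0)"
      by (auto simp: c Suc.IH)
  qed
  also have "\<dots> = (if set_mset m \<subseteq> A \<and> size m = Suc k then fact (Suc k) else 0)"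
    by simp
  finally show ?case by simp
qed

lemma taylor_fps_subst_block_sum:
  "taylor (fps_subst f (block_sum A) :: ('i, 'k::field_char_0) mps) m = (if set_mset m \<subseteq> A then fact (size m) * fps_nth f (size m) else 0)"
  for A :: "'i::finite set"
proof -
  have c: "coeff (block_sum A ^ k :: ('i, 'k) mps) m = (if set_mset m \<subseteq> A \<and> size m = k then fact k else 0) / mset_fact m" for k
    unfolding taylor_block_sum_power[symmetric] by (simp add: taylor_def)
  have "coeff (fps_subst f (block_sum A)) m = (\<Sum>k\<in>{size m}. fps_nth f k * coeff (block_sum A ^ k) m)"
    unfolding fps_subst_def coeff_Abs_mps by (rule Sum_any.expand_superset) (auto simp: c)
  then show ?thesis by (simp add: taylor_def c)
qed

lemma taylor_prod_blocks:
  fixes q :: "'i::finite \<Rightarrow> nat"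
  assumes "finite N"
  shows "taylor (\<Prod>n\<in>N. fps_subst (f n) (block_sum {y. q y = n})) m =
    (if q ` set_mset m \<subseteq> N then
      \<Prod>n\<in>N. let k = size {#z \<in># m. q z = n#} in fact k * fps_nth (f n) k else 0)"
  using assms
proof (induction N arbitrary: m rule: finite_induct)
  case empty
  show ?case by (simp add: taylor_one)
next
  case (insert n N)
  let ?f = "fps_subst (f n) (block_sum {y. q y = n})"
  let ?g = "\<Prod>n\<in>N. fps_subst (f n) (block_sum {y. q y = n})"
  have "taylor (?f * ?g) m = taylor ?f {#z \<in># m. q z = n#} * taylor ?g {#z \<in># m. q z \<noteq> n#}"
  proof (rule taylor_mult_disjoint)
    fix m :: "'i multiset" assume "\<not> (\<forall>x\<in>#m. q x = n)"
    then have "taylor ?f m = 0" by (auto simp: taylor_fps_subst_block_sum)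
    then show "coeff ?f m = 0" by (simp add: taylor_def)
  next
    fix m :: "'i multiset" assume "\<exists>x\<in>#m. q x = n"
    then have "taylor ?g m = 0" unfolding insert.IH using insert.hyps by auto
    then show "coeff ?g m = 0" by (simp add: taylor_def)
  qed
  moreover have "{#z \<in># {#z \<in># m. q z \<noteq> n#}. q z = n'#} = {#z \<in># m. q z = n'#}" if "n' \<in> N" for n'
    using that insert.hyps by (auto simp: filter_filter_mset intro!: filter_mset_cong)
  moreover have "q ` set_mset {#z \<in># m. q z \<noteq> n#} \<subseteq> N \<longleftrightarrow> q ` set_mset m \<subseteq> insert n N"
    by auto
  moreover have "taylor ?f {#z \<in># m. q z = n#} =
      (let k = size {#z \<in># m. q z = n#} in fact k * fps_nth (f n) k)"
    by (auto simp: taylor_fps_subst_block_sum Let_def)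
  ultimately show ?case
    using insert.hyps by (simp add: insert.IH cong: prod.cong)
qed

text \<open>Adding \<open>y\<close> raises only the count of its own block, say from
  \<open>k\<close> to \<open>k + 1\<close>, and contributes \<open>L + k \<beta>\<close> for this
  block: the next factor in the coefficients of \<open>f_conv\<close>.\<close>

lemma mps_eq_prod_blocks:
  fixes q :: "'i::finite \<Rightarrow> nat" and g :: "('i, 'k::field_char_0) mps"
  assumes "coeff g {#} = 1"
    and rec: "\<And>y m. taylor g (add_mset y m) =
      (L (q y) + (\<Sum>z\<in>#m. if q z = q y then \<beta> (q y) else 0)) * taylor g m"
  shows "g = (\<Prod>n\<in>range q. fps_subst (f_conv (\<beta> n) (L n)) (block_sum {y. q y = n}))"
proof (rule taylor_eqI)
  fix m
  define k where "k n m = size {#z \<in># m. q z = n#}" for n m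
  have "taylor g m = (\<Prod>n\<in>range q. \<Prod>j<k n m. L n + of_nat j * \<beta> n)"
  proof (induction m)
    case empty
    show ?case using assms(1) by (simp add: taylor_empty k_def)
  next
    case (add y m)
    let ?P = "\<lambda>m n. \<Prod>j<k n m. L n + of_nat j * \<beta> n"
    have "(\<Sum>z\<in>#m. if q z = q y then \<beta> (q y) else 0) = of_nat (k (q y) m) * \<beta> (q y)"
      by (induction m) (auto simp: k_def algebra_simps)
    then have "taylor g (add_mset y m) =
        (L (q y) + of_nat (k (q y) m) * \<beta> (q y)) * (?P m (q y) * prod (?P m) (range q - {q y}))"
      using rec[of y m] add.IH by (simp add: prod.remove[of "range q" "q y"])
    also have "prod (?P m) (range q - {q y}) = prod (?P (add_mset y m)) (range q - {q y})"
      by (rule prod.cong) (auto simp: k_def)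
    also have "(L (q y) + of_nat (k (q y) m) * \<beta> (q y)) * (?P m (q y) * prod (?P (add_mset y m)) (range q - {q y}))
       = ?P (add_mset y m) (q y) * prod (?P (add_mset y m)) (range q - {q y})"
      by (simp add: k_def mult_ac)
    also have "\<dots> = prod (?P (add_mset y m)) (range q)"
      by (simp add: prod.remove[of "range q" "q y"])
    finally show ?case .
  qed
  then show "taylor g m = taylor (\<Prod>n\<in>range q. fps_subst (f_conv (\<beta> n) (L n)) (block_sum {y. q y = n})) m"
    by (simp add: taylor_prod_blocks image_subset_iff f_conv_def k_def Let_def)
qed

lemma taylor_rescale: "taylor (rescale l f) m = (\<Prod>a\<in>#m. l a) * taylor f m"
  by (simp add: taylor_def rescale_def)

lemma f_conv_one: "f_conv \<beta> 1 = f_series \<beta>"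
proof (rule fps_ext)
  fix k
  have "(\<Prod>j<k. 1 + of_nat j * \<beta>) = (\<Prod>j=1..<k. 1 + of_nat j * \<beta>)"
    by (rule prod.mono_neutral_right) (auto simp: Suc_le_eq)
  then show "fps_nth (f_conv \<beta> 1) k = fps_nth (f_series \<beta>) k"
    by (simp add: f_conv_def f_series_def)
qed

text \<open>The factor with \<open>j = 0\<close> kills all coefficients of positive degree. This
  removes the own block from the series of a vertex that is not self-dependent.\<close>

lemma fps_subst_f_conv_zero: "fps_subst (f_conv \<beta> 0) g = 1"
proof (rule mps_eqI)
  fix m
  have "fps_nth (f_conv \<beta> 0) k = (if k = 0 then 1 else 0)" for k
    by (auto simp: f_conv_def prod_zero_iff)
  then have "coeff (fps_subst (f_conv \<beta> 0) g) m = (\<Sum>k\<in>{0}. fps_nth (f_conv \<beta> 0) k * coeff (g ^ k) m)"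
    unfolding fps_subst_def coeff_Abs_mps by (intro Sum_any.expand_superset) auto
  then show "coeff (fps_subst (f_conv \<beta> 0) g) m = coeff 1 m"
    by (simp add: f_conv_def)
qed

theorem corollary44:
  fixes F :: "'i::finite \<Rightarrow> ('i, 'k::field_char_0) mps"
  assumes non_constant: "\<And>i. \<exists>m. m \<noteq> {#} \<and> coeff (F i) m \<noteq> 0"
    and normalized: "\<And>i. coeff (F i) {#} = 1"
    and connected: "connected_sdse F"
    and hopf: "hopf_sdse F"
    and desc: "\<And>j. \<exists>i. self_dependent F i \<and> descendant F i j"
  shows "\<exists>(I0 :: nat set) (J0 :: nat set) (J :: nat \<Rightarrow> 'i set) (\<beta> :: nat \<Rightarrow> 'k) (l :: 'i \<Rightarrow> 'k).
     finite I0 \<and> finite J0 \<and> I0 \<inter> J0 = {} \<and> I0 \<union> J0 \<noteq> {} \<and>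
     (\<forall>i\<in>I0 \<union> J0. J i \<noteq> {}) \<and> disjoint_family_on J (I0 \<union> J0) \<and> (\<Union>i\<in>I0 \<union> J0. J i) = UNIV \<and>
     (\<forall>j. l j \<noteq> 0) \<and>
     (\<forall>i\<in>I0. \<forall>x\<in>J i. rescale l (F x) =
        fps_subst (f_series (\<beta> i)) (block_sum (J i))
        * (\<Prod>j\<in>I0 - {i}. fps_subst (f_conv (\<beta> j) (1 + \<beta> j)) (block_sum (J j)))
        * (\<Prod>j\<in>J0. fps_subst (f_series 1) (block_sum (J j)))) \<and>
     (\<forall>i\<in>J0. \<forall>x\<in>J i. rescale l (F x) =
        (\<Prod>j\<in>I0. fps_subst (f_conv (\<beta> j) (1 + \<beta> j)) (block_sum (J j)))
        * (\<Prod>j\<in>J0 - {i}. fps_subst (f_series 1) (block_sum (J j))))"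
proof -
  define a where "a i j = taylor (F i) {#j#}" for i j
  obtain b where rec: "\<And>k j m. taylor (F k) (add_mset j m) =
      (a k j + (\<Sum>l\<in>#m. b j - a l j)) * taylor (F k) m"
    and parent: "\<And>j. \<exists>k. a k j \<noteq> 0"
    using taylor_recurrence[OF assms] unfolding a_def by metis
  have two: "taylor (F k) {#j, l#} = (a k j + (b j - a l j)) * a k l" for k j l
    using rec[of k j "{#l#}"] by (simp add: a_def)
  have three: "taylor (F k) {#j, l, p#} = (a k j + ((b j - a l j) + (b j - a p j))) *
      ((a k l + (b l - a p l)) * a k p)" for k j l p
    using rec[of k j "{#l, p#}"] two[of k l p] by (simp add: algebra_simps)
  \<comment> \<open>Both orders of adding \<open>j\<close> and \<open>l\<close> give the same
    second-order coefficient.\<close>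
  have sym_a: "(b j - a l j) * a k l = (b l - a j l) * a k j" for k l j
  proof -
    have "(a k j + (b j - a l j)) * a k l = (a k l + (b l - a j l)) * a k j"
      unfolding two[symmetric] by (simp add: add_mset_commute)
    then show ?thesis by (simp add: algebra_simps)
  qed
  \<comment> \<open>Third-order coefficients are compared, with \<open>k\<close> a parent of
    \<open>p\<close> so that the factor \<open>a k p\<close> cancels. The terms from rows
    \<open>k\<close> and \<open>p\<close> of \<open>a\<close> match by \<open>sym_a\<close>, and
    those in \<open>b\<close> remain.\<close>
  have sym_b: "(b j - a l j) * b l = (b l - a j l) * b j" for l j
  proof -
    obtain p where "a p l \<noteq> 0" using parent by blast
    obtain k where k: "a k p \<noteq> 0" using parent by blast
    let ?u = "b j - a l j" and ?v = "b l - a j l"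
    have "taylor (F k) {#j, l, p#} = taylor (F k) {#l, j, p#}"
      by (simp add: add_mset_commute)
    then have "(a k j + (?u + (b j - a p j))) * (a k l + (b l - a p l)) =
        (a k l + (?v + (b l - a p l))) * (a k j + (b j - a p j))"
      using k unfolding three by simp
    then have "?u * a k l + ?u * b l - ?u * a p l = ?v * a k j + ?v * b j - ?v * a p j"
      by (simp add: algebra_simps)
    then show ?thesis using sym_a[of j l k] sym_a[of j l p] by simp
  qed
  obtain q :: "'i \<Rightarrow> nat" and \<beta> :: "nat \<Rightarrow> 'k" and S l where l: "\<And>j. l j \<noteq> 0"
    and l_a: "\<And>x y. l y * a x y =
      (if q y \<in> S then if q x = q y then 1 else 1 + \<beta> (q y) else if q x = q y then 0 else 1)"
    and l_e: "\<And>x y. l y * (b y - a x y) = (if q x = q y then \<beta> (q y) else 0)"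
    and \<beta>_1: "\<And>y. q y \<notin> S \<Longrightarrow> \<beta> (q y) = 1"
    by (rule classification[OF parent sym_a sym_b]) blast
  define J where "J n = {y. q y = n}" for n
  \<comment> \<open>The linear coefficient, after the change of variables, at a vertex of block
    \<open>n\<close> in the series of a vertex of block \<open>i\<close>.\<close>
  define L where "L i n = (if n \<in> S then if i = n then 1 else 1 + \<beta> n else if i = n then 0 else 1)" for i n
  define G where "G i n = fps_subst (f_conv (\<beta> n) (L i n)) (block_sum (J n))" for i n
  define I0 where "I0 = range q \<inter> S"
  define J0 where "J0 = range q - S"
  have F: "rescale l (F x) = (\<Prod>n\<in>range q. G (q x) n)" for x
    unfolding G_def J_def
  proof (rule mps_eq_prod_blocks)
    show "coeff (rescale l (F x)) {#} = 1" by (simp add: rescale_def normalized)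
    fix y m
    have "l y * (a x y + (\<Sum>z\<in>#m. b y - a z y)) = l y * a x y + (\<Sum>z\<in>#m. l y * (b y - a z y))"
      by (simp add: distrib_left sum_mset_distrib_left)
    also have "\<dots> = L (q x) (q y) + (\<Sum>z\<in>#m. if q z = q y then \<beta> (q y) else 0)"
      by (simp add: l_a l_e L_def)
    finally show "taylor (rescale l (F x)) (add_mset y m) =
      (L (q x) (q y) + (\<Sum>z\<in>#m. if q z = q y then \<beta> (q y) else 0)) * taylor (rescale l (F x)) m"
      by (simp add: taylor_rescale rec[of x y m] mult_ac)
  qed
  have IJ: "range q = I0 \<union> J0" "I0 \<inter> J0 = {}" "finite I0" "finite J0"
    by (auto simp: I0_def J0_def)
  have F_split: "rescale l (F x) = (\<Prod>n\<in>I0. G (q x) n) * (\<Prod>n\<in>J0. G (q x) n)" for x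
    unfolding F IJ(1) using IJ by (intro prod.union_disjoint) auto
  have G_I0: "(\<Prod>n\<in>A. G i n) = (\<Prod>n\<in>A. fps_subst (f_conv (\<beta> n) (1 + \<beta> n)) (block_sum (J n)))"
    if "A \<subseteq> I0 - {i}" for A i
    using that by (intro prod.cong) (auto simp: G_def L_def I0_def)
  \<comment> \<open>For these blocks both parameters equal 1, and \<open>f_conv 1 1\<close> is
    \<open>f_series 1\<close>.\<close>
  have G_J0: "(\<Prod>n\<in>A. G i n) = (\<Prod>n\<in>A. fps_subst (f_series 1) (block_sum (J n)))"
    if "A \<subseteq> J0 - {i}" for A i
  proof (rule prod.cong)
    fix n assume "n \<in> A"
    then have "n \<in> range q" "n \<notin> S" "i \<noteq> n" using that by (auto simp: J0_def)
    moreover from this have "\<beta> n = 1" using \<beta>_1 by auto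
    ultimately show "G i n = fps_subst (f_series 1) (block_sum (J n))"
      by (simp add: G_def L_def f_conv_one)
  qed simp
  show ?thesis
  proof (rule exI[of _ I0], rule exI[of _ J0], rule exI[of _ J], rule exI[of _ \<beta>], rule exI[of _ l],
      intro conjI ballI)
    show "I0 \<union> J0 \<noteq> {}" using IJ(1) by auto
    show "J i \<noteq> {}" if "i \<in> I0 \<union> J0" for i
      using that unfolding IJ(1)[symmetric] by (auto simp: J_def)
    show "disjoint_family_on J (I0 \<union> J0)" by (auto simp: disjoint_family_on_def J_def)
    show "(\<Union>i\<in>I0 \<union> J0. J i) = UNIV" unfolding IJ(1)[symmetric] by (auto simp: J_def)
    show "\<forall>j. l j \<noteq> 0" using l by blast
    show "rescale l (F x) =
        fps_subst (f_series (\<beta> i)) (block_sum (J i))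
        * (\<Prod>j\<in>I0 - {i}. fps_subst (f_conv (\<beta> j) (1 + \<beta> j)) (block_sum (J j)))
        * (\<Prod>j\<in>J0. fps_subst (f_series 1) (block_sum (J j)))" if i: "i \<in> I0" and x: "x \<in> J i" for i x
    proof -
      have "q x = i" using x by (simp add: J_def)
      then have "rescale l (F x) = G i i * (\<Prod>n\<in>I0 - {i}. G i n) * (\<Prod>n\<in>J0. G i n)"
        unfolding F_split using i IJ(3) by (simp add: prod.remove)
      moreover have "G i i = fps_subst (f_series (\<beta> i)) (block_sum (J i))"
        using i by (simp add: G_def L_def I0_def f_conv_one)
      moreover have "J0 \<subseteq> J0 - {i}" using i IJ(2) by auto
      ultimately show ?thesis by (simp add: G_I0 G_J0)
    qed
    show "rescale l (F x) =
        (\<Prod>j\<in>I0. fps_subst (f_conv (\<beta> j) (1 + \<beta> j)) (block_sum (J j)))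
        * (\<Prod>j\<in>J0 - {i}. fps_subst (f_series 1) (block_sum (J j)))" if i: "i \<in> J0" and x: "x \<in> J i" for i x
    proof -
      have "q x = i" using x by (simp add: J_def)
      then have "rescale l (F x) = (\<Prod>n\<in>I0. G i n) * (G i i * (\<Prod>n\<in>J0 - {i}. G i n))"
        unfolding F_split using i IJ(4) by (simp add: prod.remove)
      moreover have "G i i = 1"
        using i by (simp add: G_def L_def J0_def fps_subst_f_conv_zero)
      moreover have "I0 \<subseteq> I0 - {i}" using i IJ(2) by auto
      ultimately show ?thesis by (simp add: G_I0 G_J0)
    qed
  qed (use IJ in auto)
qed

end
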